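(* Let $\Omega\subset\mathbb{C}^n$ be a bounded pseudoconvex Reinhardt domain, $1<p<\infty$, $q=p/(p-1)$, and $\lambda$ an admissible multi-radial weight on $\Omega$. If the Monomial Basis Projection $\bm{P}^{\Omega}_{p,\lambda}:L^p(\Omega,\lambda)\to A^p(\Omega,\lambda)$ exists, then for every $f\in L^p(\Omega,\lambda)$ and $z\in\Omega$, $$\bm{P}^{\Omega}_{p,\lambda}(f)(z)=\int_\Omega K^{\Omega}_{p,\lambda}(z,w)f(w)\lambda(w)\,dV(w),$$ and for each $z\in\Omega$ we have $K^{\Omega}_{p,\lambda}(z,\cdot)\in L^q(\Omega,\lambda)$.
   Context: A domain $\Omega$ is Reinhardt (centered at $0$) if $(e^{i\theta_1}z_1,\dots,e^{i\theta_n}z_n)\in\Omega$ whenever $z\in\Omega$, $\theta\in\mathbb{R}^n$. For a measurable $\lambda:\Omega\to[0,\infty]$, positive a.e., $\|f\|_{p,\lambda}^p=\int_\Omega|f|^p\lambda\,dV$ ($dV$ Lebesgue measure), $L^p(\Omega,\lambda)$ is the corresponding space and $A^p(\Omega,\lambda)=L^p(\Omega,\lambda)\cap\mathcal{O}(\Omega)$. $\lambda$ is admissible if for each compact $K\subset\Omega$ there is $C_K$ with $\sup_K|f|\le C_K\|f\|_{p,\lambda}$ for all $f\in A^p(\Omega,\lambda)$; multi-radial if $\lambda(z)$ depends only on $(|z_1|,\dots,|z_n|)$. $e_\alpha(z)=z_1^{\alpha_1}\cdots z_n^{\alpha_n}$ for $\alpha\in\mathbb{Z}^n$, $|\alpha|_\infty=\max_j|\alpha_j|$,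 $\mathcal{S}_p(\Omega,\lambda)=\{\alpha:e_\alpha\in A^p(\Omega,\lambda)\}$. Monomial Basis Kernel: $K^{\Omega}_{p,\lambda}(z,w)=\sum_{\alpha\in\mathcal{S}_p(\Omega,\lambda)}e_\alpha(z)\overline{e_\alpha(w)}|e_\alpha(w)|^{p-2}/\|e_\alpha\|_{p,\lambda}^p$. Each $f\in\mathcal{O}(\Omega)$ has a unique locally normally convergent Laurent expansion $f=\sum_\alpha c_\alpha e_\alpha$; set $a_\alpha(f)=c_\alpha$. Restricted to $A^p(\Omega,\lambda)$, $a_\alpha$ is bounded, and $\widetilde{a}_\alpha$ denotes its unique norm-preserving extension to $L^p(\Omega,\lambda)$. The Monomial Basis Projection of $A^p(\Omega,\lambda)$ (if it exists) is a bounded linear projection $\bm{P}^\Omega_{p,\lambda}$ from $L^p(\Omega,\lambda)$ onto $A^p(\Omega,\lambda)$ such that for every $f\in L^p(\Omega,\lambda)$, $\bm{P}^\Omega_{p,\lambda}f=\lim_{N\to\infty}\sum_{\alpha\in\mathcal{S}_p(\Omega,\lambda),|\alpha|_\infty\le N}\widetilde{a}_\alpha(f)e_\alpha$ in the norm of $L^p(\Omega,\lambda)$. *)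

theory Defs
  imports "HOL-Analysis.Analysis"
begin

definition cdomain :: "(complex^'n) set \<Rightarrow> bool" where
  "cdomain \<Omega> \<longleftrightarrow> open \<Omega> \<and> connected \<Omega> \<and> \<Omega> \<noteq> {}"

definition reinhardt :: "(complex^'n) set \<Rightarrow> bool" where
  "reinhardt \<Omega> \<longleftrightarrow>
     (\<forall>z\<in>\<Omega>. \<forall>\<theta>::'n \<Rightarrow> real. (\<chi> j. exp (\<i> * of_real (\<theta> j)) * z$j) \<in> \<Omega>)"

definition cont_psh :: "(complex^'n) set \<Rightarrow> (complex^'n \<Rightarrow> real) \<Rightarrow> bool" where
  "cont_psh \<Omega> u \<longleftrightarrow> continuous_on \<Omega> u \<and>
     (\<forall>a b. (\<forall>\<zeta>::complex. norm \<zeta> \<le> 1 \<longrightarrow> a + \<zeta> *s b \<in> \<Omega>) \<longrightarrow>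
        u a \<le> (1 / (2*pi)) * integral {0..2*pi} (\<lambda>t. u (a + exp (\<i> * of_real t) *s b)))"

definition pseudoconvex :: "(complex^'n) set \<Rightarrow> bool" where
  "pseudoconvex \<Omega> \<longleftrightarrow> (\<exists>\<phi>. cont_psh \<Omega> \<phi> \<and>
     (\<forall>c::real. compact (closure {z\<in>\<Omega>. \<phi> z < c}) \<and> closure {z\<in>\<Omega>. \<phi> z < c} \<subseteq> \<Omega>))"

definition holo_n :: "(complex^'n) set \<Rightarrow> (complex^'n \<Rightarrow> complex) \<Rightarrow> bool" where
  "holo_n \<Omega> f \<longleftrightarrow> (\<forall>z\<in>\<Omega>. \<exists>L. (f has_derivative L) (at z) \<and> (\<forall>c v. L (c *s v) = c * L v))"

definition wmeasure :: "(complex^'n) set \<Rightarrow> (complex^'n \<Rightarrow> ennreal) \<Rightarrow> (complex^'n) measure" where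
  "wmeasure \<Omega> wt = density lebesgue (\<lambda>z. wt z * indicator \<Omega> z)"

definition Lp_space :: "(complex^'n) set \<Rightarrow> (complex^'n \<Rightarrow> ennreal) \<Rightarrow> real \<Rightarrow> (complex^'n \<Rightarrow> complex) set" where
  "Lp_space \<Omega> wt p = {f. f \<in> borel_measurable (wmeasure \<Omega> wt) \<and>
      (\<integral>\<^sup>+ z. ennreal (norm (f z) powr p) \<partial>wmeasure \<Omega> wt) < \<infinity>}"

definition Lpnorm :: "(complex^'n) set \<Rightarrow> (complex^'n \<Rightarrow> ennreal) \<Rightarrow> real \<Rightarrow> (complex^'n \<Rightarrow> complex) \<Rightarrow> real" where
  "Lpnorm \<Omega> wt p f = enn2real (\<integral>\<^sup>+ z. ennreal (norm (f z) powr p) \<partial>wmeasure \<Omega> wt) powr (1/p)"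

definition Ap_space :: "(complex^'n) set \<Rightarrow> (complex^'n \<Rightarrow> ennreal) \<Rightarrow> real \<Rightarrow> (complex^'n \<Rightarrow> complex) set" where
  "Ap_space \<Omega> wt p = {f \<in> Lp_space \<Omega> wt p. holo_n \<Omega> f}"

definition admissible :: "(complex^'n) set \<Rightarrow> (complex^'n \<Rightarrow> ennreal) \<Rightarrow> real \<Rightarrow> bool" where
  "admissible \<Omega> wt p \<longleftrightarrow> (\<forall>K. compact K \<and> K \<subseteq> \<Omega> \<longrightarrow>
     (\<exists>C. \<forall>f\<in>Ap_space \<Omega> wt p. \<forall>z\<in>K. norm (f z) \<le> C * Lpnorm \<Omega> wt p f))"

definition multi_radial :: "(complex^'n) set \<Rightarrow> (complex^'n \<Rightarrow> ennreal) \<Rightarrow> bool" where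
  "multi_radial \<Omega> wt \<longleftrightarrow>
     (\<forall>z\<in>\<Omega>. \<forall>w\<in>\<Omega>. (\<forall>j. norm (z$j) = norm (w$j)) \<longrightarrow> wt z = wt w)"

definition monom :: "('n::finite \<Rightarrow> int) \<Rightarrow> complex^'n \<Rightarrow> complex" where
  "monom \<alpha> z = (\<Prod>j\<in>UNIV. (z$j) powi (\<alpha> j))"

definition supnorm :: "('n::finite \<Rightarrow> int) \<Rightarrow> int" where
  "supnorm \<alpha> = Max (range (\<lambda>j. \<bar>\<alpha> j\<bar>))"

definition Sp_set :: "(complex^'n::finite) set \<Rightarrow> (complex^'n \<Rightarrow> ennreal) \<Rightarrow> real \<Rightarrow> ('n \<Rightarrow> int) set" where
  "Sp_set \<Omega> wt p = {\<alpha>. monom \<alpha> \<in> Ap_space \<Omega> wt p}"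

definition laurent_series :: "(complex^'n::finite) set \<Rightarrow> (complex^'n \<Rightarrow> complex) \<Rightarrow> (('n \<Rightarrow> int) \<Rightarrow> complex) \<Rightarrow> bool" where
  "laurent_series \<Omega> f c \<longleftrightarrow>
     (\<forall>z\<in>\<Omega>. ((\<lambda>\<alpha>. c \<alpha> * monom \<alpha> z) has_sum f z) UNIV) \<and>
     (\<forall>K. compact K \<and> K \<subseteq> \<Omega> \<and> K \<noteq> {} \<longrightarrow>
        (\<lambda>\<alpha>. SUP z\<in>K. norm (c \<alpha> * monom \<alpha> z)) summable_on UNIV)"

definition laurent_coeff :: "(complex^'n::finite) set \<Rightarrow> ('n \<Rightarrow> int) \<Rightarrow> (complex^'n \<Rightarrow> complex) \<Rightarrow> complex" where
  "laurent_coeff \<Omega> \<alpha> f = (THE c. laurent_series \<Omega> f c) \<alpha>"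

definition coeff_opnorm :: "(complex^'n::finite) set \<Rightarrow> (complex^'n \<Rightarrow> ennreal) \<Rightarrow> real \<Rightarrow> ('n \<Rightarrow> int) \<Rightarrow> real" where
  "coeff_opnorm \<Omega> wt p \<alpha> = Sup ({norm (laurent_coeff \<Omega> \<alpha> f) / Lpnorm \<Omega> wt p f | f.
       f \<in> Ap_space \<Omega> wt p \<and> Lpnorm \<Omega> wt p f > 0} \<union> {0})"

text \<open>The norm-preserving (Hahn-Banach) extension of a_alpha to L^p
  (normalised to be 0 outside L^p so that it is unique as a HOL function).\<close>
definition ext_coeff :: "(complex^'n::finite) set \<Rightarrow> (complex^'n \<Rightarrow> ennreal) \<Rightarrow> real \<Rightarrow> ('n \<Rightarrow> int)
     \<Rightarrow> (complex^'n \<Rightarrow> complex) \<Rightarrow> complex" where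
  "ext_coeff \<Omega> wt p \<alpha> = (THE \<Phi>.
      (\<forall>f. f \<notin> Lp_space \<Omega> wt p \<longrightarrow> \<Phi> f = 0) \<and>
      (\<forall>f\<in>Ap_space \<Omega> wt p. \<Phi> f = laurent_coeff \<Omega> \<alpha> f) \<and>
      (\<forall>f\<in>Lp_space \<Omega> wt p. \<forall>g\<in>Lp_space \<Omega> wt p. \<Phi> (\<lambda>z. f z + g z) = \<Phi> f + \<Phi> g) \<and>
      (\<forall>f\<in>Lp_space \<Omega> wt p. \<forall>c. \<Phi> (\<lambda>z. c * f z) = c * \<Phi> f) \<and>
      (\<forall>f\<in>Lp_space \<Omega> wt p. norm (\<Phi> f) \<le> coeff_opnorm \<Omega> wt p \<alpha> * Lpnorm \<Omega> wt p f))"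

definition trunc_set :: "(complex^'n::finite) set \<Rightarrow> (complex^'n \<Rightarrow> ennreal) \<Rightarrow> real \<Rightarrow> nat \<Rightarrow> ('n \<Rightarrow> int) set" where
  "trunc_set \<Omega> wt p N = {\<alpha> \<in> Sp_set \<Omega> wt p. supnorm \<alpha> \<le> int N}"

definition is_MBP :: "(complex^'n::finite) set \<Rightarrow> (complex^'n \<Rightarrow> ennreal) \<Rightarrow> real
     \<Rightarrow> ((complex^'n \<Rightarrow> complex) \<Rightarrow> (complex^'n \<Rightarrow> complex)) \<Rightarrow> bool" where
  "is_MBP \<Omega> wt p P \<longleftrightarrow>
     (\<forall>f\<in>Lp_space \<Omega> wt p. P f \<in> Ap_space \<Omega> wt p) \<and>
     (\<forall>f\<in>Lp_space \<Omega> wt p. \<forall>g\<in>Lp_space \<Omega> wt p. \<forall>z\<in>\<Omega>. P (\<lambda>w. f w + g w) z = P f z + P g z) \<and>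
     (\<forall>f\<in>Lp_space \<Omega> wt p. \<forall>c. \<forall>z\<in>\<Omega>. P (\<lambda>w. c * f w) z = c * P f z) \<and>
     (\<exists>C. \<forall>f\<in>Lp_space \<Omega> wt p. Lpnorm \<Omega> wt p (P f) \<le> C * Lpnorm \<Omega> wt p f) \<and>
     (\<forall>g\<in>Ap_space \<Omega> wt p. \<forall>z\<in>\<Omega>. P g z = g z) \<and>
     (\<forall>f\<in>Lp_space \<Omega> wt p.
        (\<lambda>N. Lpnorm \<Omega> wt p (\<lambda>z. P f z -
            (\<Sum>\<alpha>\<in>trunc_set \<Omega> wt p N. ext_coeff \<Omega> wt p \<alpha> f * monom \<alpha> z))) \<longlonglongrightarrow> 0)"

definition mb_kernel :: "(complex^'n::finite) set \<Rightarrow> (complex^'n \<Rightarrow> ennreal) \<Rightarrow> real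
     \<Rightarrow> complex^'n \<Rightarrow> complex^'n \<Rightarrow> complex" where
  "mb_kernel \<Omega> wt p z w = lim (\<lambda>N. \<Sum>\<alpha>\<in>trunc_set \<Omega> wt p N.
      monom \<alpha> z * cnj (monom \<alpha> w) * of_real (norm (monom \<alpha> w) powr (p - 2))
        / of_real (Lpnorm \<Omega> wt p (monom \<alpha>) powr p))"

end

theory Submission
  imports Defs
begin

text \<open>
  Write \<open>\<parallel>\<cdot>\<parallel>\<close> for the norm of \<open>L\<^sup>p(\<Omega>, \<lambda>)\<close>. The weighted measure is invariant under rotations of
  single coordinates, so the functional
  \<open>\<ell>\<^sub>\<alpha>(f) = \<parallel>e\<^sub>\<alpha>\<parallel>\<^sup>-\<^sup>p \<integral> f cnj(e\<^sub>\<alpha>) \<bar>e\<^sub>\<alpha>\<bar>\<^sup>p\<^sup>-\<^sup>2 \<lambda>\<close> takes the value 1 at \<open>e\<^sub>\<alpha>\<close> and 0 at all other monomials, and by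
  Hoelder its norm is \<open>1 / \<parallel>e\<^sub>\<alpha>\<parallel>\<close>. Since every \<open>g\<close> in \<open>A\<^sup>p\<close> is fixed by the projection, it is a norm
  limit of Laurent polynomials; this identifies its Laurent coefficients with \<open>\<ell>\<^sub>\<alpha>(g)\<close>, and smoothness
  of the \<open>L\<^sup>p\<close> norm makes \<open>\<ell>\<^sub>\<alpha>\<close> the only norm-preserving extension.

  The series of the kernel converges because admissibility, applied to a slightly larger polydisc,
  gives \<open>\<bar>e\<^sub>\<alpha>(z)\<bar> \<le> C \<rho>\<^sup>\<bar>\<^sup>\<alpha>\<^sup>\<bar> \<parallel>e\<^sub>\<alpha>\<parallel>\<close> with \<open>\<rho> < 1\<close>: the \<open>L\<^sup>q\<close> norms of its terms are
  \<open>\<bar>e\<^sub>\<alpha>(z)\<bar> / \<parallel>e\<^sub>\<alpha>\<parallel>\<close>, hence summable. The integral formula follows by dominated convergence.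
\<close>


section \<open>Rotation invariance of Lebesgue measure\<close>

text \<open>\<open>laurent_coeff\<close> and \<open>ext_coeff\<close> are definite descriptions, so
  neither can be evaluated before existence and uniqueness are settled, yet \<open>is_MBP\<close>
  speaks of \<open>ext_coeff\<close> from the start. The circle is broken by reading the norm
  convergence in \<open>is_MBP\<close> as a statement about unknown coefficients: a continuous
  functional that isolates one exponent determines them on A^p without any knowledge of the
  extension. Only the Laurent expansions obtained in this way give the operator norm that the
  description of \<open>ext_coeff\<close> refers to.

  A second obstacle is that \<open>powi\<close> is total: a negative power of 0 is 0, so values on a
  coordinate hyperplane say nothing about growth near it. Admissibility must exclude negative
  exponents there before any geometric gain is possible.

  The factor cnj(e)|e|^(p-2) comes from calculus: the derivative of |e|^p / p in direction b is Re(b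
  cnj(e)|e|^(p-2)). This is why the extension, and with it the kernel, carries this factor.\<close>

lemma orthogonal_transformation_rot2:
  fixes u :: complex
  assumes "norm u = 1"
  shows "orthogonal_transformation (\<lambda>v::real^2. vector [Re u * v$1 - Im u * v$2, Im u * v$1 + Re u * v$2] :: real^2)"
proof -
  have "(Re u)\<^sup>2 + (Im u)\<^sup>2 = 1"
    using assms by (simp add: cmod_def)
  then show ?thesis
    unfolding orthogonal_transformation_def
    by (auto intro!: linearI simp: vec_eq_iff forall_2 inner_vec_def sum_2 algebra_simps power2_eq_square) algebra
qed

lemma lborel_complex_eq_distr: "(lborel :: complex measure) = distr (lborel::(real^2) measure) borel (\<lambda>v. Complex (v$1) (v$2))"
proof (rule lborel_eqI)
  have [measurable]: "(\<lambda>v::real^2. Complex (v$1) (v$2)) \<in> borel_measurable borel"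
    unfolding complex_eq by (intro borel_measurable_continuous_onI continuous_intros)
  fix l u :: complex
  assume le: "\<And>b. b \<in> Basis \<Longrightarrow> l \<bullet> b \<le> u \<bullet> b"
  have "(\<lambda>v::real^2. Complex (v$1) (v$2)) -` box l u = box (vector [Re l, Im l]) (vector [Re u, Im u])"
    by (auto simp: box_def Basis_complex_def forall_2 inner_axis Basis_vec_def inner_complex_def)
  then show "emeasure (distr (lborel::(real^2) measure) borel (\<lambda>v. Complex (v$1) (v$2))) (box l u) = ennreal (\<Prod>b\<in>Basis. (u - l) \<bullet> b)"
    using le[of 1] le[of \<i>]
    by (simp add: emeasure_distr emeasure_lborel_box_eq Basis_complex_def inner_complex_def Basis_vec_def forall_2 inner_axis UNIV_2 axis_eq_axis)
qed simp

text \<open>A rotated box is in general not a box, so box formulas do not apply. The claim is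
  carried to \<open>real^2\<close>, where multiplication by \<open>u\<close> is an orthogonal
  map.\<close>

lemma emeasure_lborel_complex_rotation:
  fixes u :: complex
  assumes u: "norm u = 1"
  shows "emeasure lborel ((\<lambda>z. u * z) -` box l r) = emeasure lborel (box l r)"
proof -
  define C :: "real^2 \<Rightarrow> complex" where "C v = Complex (v$1) (v$2)" for v
  define R :: "real^2 \<Rightarrow> real^2"
    where "R v = vector [Re u * v$1 - Im u * v$2, Im u * v$1 + Re u * v$2]" for v
  have R: "orthogonal_transformation R"
    using orthogonal_transformation_rot2[OF u] unfolding R_def .
  have Cm [measurable]: "C \<in> borel_measurable borel"
    unfolding C_def complex_eq by (intro borel_measurable_continuous_onI continuous_intros)
  have eq: "emeasure lborel S = emeasure lborel (C -` S)" if "S \<in> sets borel" for S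
    unfolding lborel_complex_eq_distr C_def[symmetric] using that by (simp add: emeasure_distr)
  have CR: "C (R v) = u * C v" for v
    by (simp add: C_def R_def complex_eq_iff)
  have Cbox: "C -` box l r = box (vector [Re l, Im l]) (vector [Re r, Im r])"
    by (auto simp: C_def box_def Basis_complex_def forall_2 inner_axis Basis_vec_def inner_complex_def)
  have mm [measurable]: "(\<lambda>z. u * z) -` box l r \<in> sets borel"
    using measurable_sets_borel[of "\<lambda>z. u * z" borel "box l r"] by simp
  \<comment> \<open>A preimage becomes an image under the inverse rotation, the form to which
    \<open>measure_orthogonal_image\<close> applies.\<close>
  have sub: "C -` (\<lambda>z. u * z) -` box l r = inv R ` (C -` box l r)"
    using orthogonal_transformation_bij[OF R] 
    by (auto simp: CR[symmetric] bij_image_Collect_eq vimage_def bij_def image_iff inv_f_f surj_f_inv_f) (metis inv_f_f)+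
  have Ri: "orthogonal_transformation (inv R)"
    using R orthogonal_transformation_inv by blast
  have lm: "C -` box l r \<in> lmeasurable"
    unfolding Cbox by simp
  have bb: "C -` (\<lambda>z. u * z) -` box l r \<in> sets borel"
    using measurable_sets_borel[OF Cm mm] by simp
  have "emeasure lborel ((\<lambda>z. u * z) -` box l r) = emeasure lborel (C -` (\<lambda>z. u * z) -` box l r)"
    by (rule eq) measurable
  also have "\<dots> = emeasure lebesgue (C -` (\<lambda>z. u * z) -` box l r)"
    using bb by simp
  also have "\<dots> = emeasure lebesgue (C -` box l r)"
    unfolding sub
    using measure_orthogonal_image[OF Ri lm] measurable_orthogonal_image[OF Ri lm] lm
    by (simp add: emeasure_eq_measure2)
  also have "\<dots> = emeasure lborel (C -` box l r)"
    unfolding Cbox by simp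
  also have "\<dots> = emeasure lborel (box l r)"
    by (rule eq[symmetric]) simp
  finally show ?thesis .
qed

lemma measurable_vec_lambda [measurable]:
  "(\<lambda>f. \<chi> i. f i) \<in> (\<Pi>\<^sub>M i\<in>(UNIV::'n::finite set). (lborel::'a::euclidean_space measure)) \<rightarrow>\<^sub>M borel"
  by (subst borel_measurable_euclidean_space) (auto simp: Basis_vec_def inner_axis)

text \<open>Turns Lebesgue measure on vectors into a product measure, so that a map acting
  coordinatewise can be treated one factor at a time.\<close>

lemma lborel_vec_eq_distr:
  "(lborel :: ('a::euclidean_space^'n) measure) = distr (\<Pi>\<^sub>M i\<in>UNIV. lborel) borel (\<lambda>f. \<chi> i. f i)"
proof (rule lborel_eqI)
  interpret product_sigma_finite "\<lambda>_::'n. lborel :: 'a measure" ..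
  fix l u :: "'a^'n"
  assume le: "\<And>b. b \<in> Basis \<Longrightarrow> l \<bullet> b \<le> u \<bullet> b"
  have le': "b \<in> Basis \<Longrightarrow> l$i \<bullet> b \<le> u$i \<bullet> b" for i b
    using le[of "axis i b"] by (auto simp: inner_axis Basis_vec_def)
  have "(\<lambda>f. \<chi> i. f i) -` box l u \<inter> space (\<Pi>\<^sub>M i\<in>(UNIV::'n set). (lborel::'a measure)) = (\<Pi>\<^sub>E i\<in>UNIV. box (l$i) (u$i))"
    by (auto simp: space_PiM box_def Basis_vec_def inner_axis PiE_def)
  then have "emeasure (distr (\<Pi>\<^sub>M i\<in>(UNIV::'n set). (lborel::'a measure)) borel (\<lambda>f. \<chi> i. f i)) (box l u)
     = emeasure (\<Pi>\<^sub>M i\<in>(UNIV::'n set). (lborel::'a measure)) (\<Pi>\<^sub>E i\<in>UNIV. box (l$i) (u$i))"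
    by (simp add: emeasure_distr)
  also have "\<dots> = (\<Prod>i\<in>UNIV. emeasure lborel (box (l$i) (u$i)))"
    by (rule emeasure_PiM) auto
  also have "\<dots> = (\<Prod>i\<in>UNIV. ennreal (\<Prod>b\<in>Basis. (u$i - l$i) \<bullet> b))"
    by (intro prod.cong refl) (auto simp: emeasure_lborel_box_eq le')
  also have "\<dots> = ennreal (\<Prod>i\<in>UNIV. \<Prod>b\<in>Basis. (u$i - l$i) \<bullet> b)"
    by (rule prod_ennreal) (auto intro!: prod_nonneg simp: le' inner_diff_left)
  also have "(\<Prod>i\<in>UNIV. \<Prod>b\<in>Basis. (u$i - l$i) \<bullet> b) = (\<Prod>b\<in>Basis. (u - l) \<bullet> b)"
  proof -
    have "(\<Prod>b\<in>Basis. (u - l) \<bullet> b) = (\<Prod>ib\<in>UNIV\<times>Basis. (u - l) \<bullet> axis (fst ib) (snd ib))"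
      by (rule prod.reindex_bij_betw[symmetric])
        (auto simp: bij_betw_def inj_on_def axis_eq_axis Basis_vec_def image_iff nonzero_Basis)
    then show ?thesis
      by (simp add: prod.cartesian_product case_prod_unfold inner_axis)
  qed
  finally show "emeasure (distr (\<Pi>\<^sub>M i\<in>(UNIV::'n set). (lborel::'a measure)) borel (\<lambda>f. \<chi> i. f i)) (box l u)
     = ennreal (\<Prod>b\<in>Basis. (u - l) \<bullet> b)" .
qed simp

text \<open>For unimodular \<open>u\<close> this is the action in \<open>reinhardt\<close>; unit
  numbers in place of angles turn inverses and powers into plain algebra.\<close>

definition torus_act :: "('n \<Rightarrow> complex) \<Rightarrow> complex^'n \<Rightarrow> complex^'n" where
  "torus_act u z = (\<chi> i. u i * z$i)"

lemma torus_act_measurable [measurable]: "torus_act u \<in> borel_measurable borel"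
  unfolding torus_act_def by (intro borel_measurable_continuous_onI continuous_intros)

lemma distr_lborel_torus_act:
  fixes u :: "'n::finite \<Rightarrow> complex"
  assumes u: "\<And>i. norm (u i) = 1"
  shows "distr lborel borel (torus_act u) = lborel"
proof (rule lborel_eqI[symmetric])
  interpret product_sigma_finite "\<lambda>_::'n. lborel :: complex measure" ..
  let ?M = "\<Pi>\<^sub>M i\<in>(UNIV::'n set). (lborel::complex measure)"
  fix l r :: "complex^'n"
  assume le: "\<And>b. b \<in> Basis \<Longrightarrow> l \<bullet> b \<le> r \<bullet> b"
  have vm: "torus_act u -` box l r \<in> sets borel"
    by (rule measurable_sets_borel[OF torus_act_measurable]) simp
  have mm: "(\<lambda>z. u i * z) -` box (l$i) (r$i) \<in> sets lborel" for i
    using measurable_sets_borel[of "\<lambda>z. u i * z" borel "box (l$i) (r$i)"] by simp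
  have "emeasure (distr lborel borel (torus_act u)) (box l r)
     = emeasure lborel (torus_act u -` box l r)"
    by (simp add: emeasure_distr)
  also have "\<dots> = emeasure ?M ((\<lambda>f. \<chi> i. f i) -` (torus_act u -` box l r) \<inter> space ?M)"
    by (subst lborel_vec_eq_distr) (rule emeasure_distr[OF measurable_vec_lambda vm])
  also have "(\<lambda>f. \<chi> i. f i) -` (torus_act u -` box l r) \<inter> space ?M = (\<Pi>\<^sub>E i\<in>UNIV. (\<lambda>z. u i * z) -` box (l$i) (r$i))"
    by (auto simp: torus_act_def space_PiM box_def Basis_vec_def inner_axis PiE_def)
  also have "emeasure ?M \<dots> = (\<Prod>i\<in>UNIV. emeasure lborel ((\<lambda>z. u i * z) -` box (l$i) (r$i)))"
    by (rule emeasure_PiM) (auto simp only: finite_UNIV intro!: finite mm)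
  also have "\<dots> = (\<Prod>i\<in>UNIV. emeasure lborel (box (l$i) (r$i)))"
    by (simp add: emeasure_lborel_complex_rotation u)
  also have "\<dots> = emeasure ?M (\<Pi>\<^sub>E i\<in>UNIV. box (l$i) (r$i))"
    by (rule emeasure_PiM[symmetric]) auto
  also have "(\<Pi>\<^sub>E i\<in>UNIV. box (l$i) (r$i)) = (\<lambda>f. \<chi> i. f i) -` (box l r) \<inter> space ?M"
    by (auto simp: space_PiM box_def Basis_vec_def inner_axis PiE_def)
  also have "emeasure ?M \<dots> = emeasure lborel (box l r)"
    by (subst lborel_vec_eq_distr) (simp add: emeasure_distr)
  also have "\<dots> = ennreal (\<Prod>b\<in>Basis. (r - l) \<bullet> b)"
    using le by (simp add: emeasure_lborel_box_eq)
  finally show "emeasure (distr lborel borel (torus_act u)) (box l r) = ennreal (\<Prod>b\<in>Basis. (r - l) \<bullet> b)" .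
qed simp

text \<open>The weight is only Lebesgue measurable, so invariance has to pass to the completion. It
  does, because a map preserving \<open>lborel\<close> pulls null sets back to null sets.\<close>

lemma
  fixes T :: "'a::euclidean_space \<Rightarrow> 'a"
  assumes T_borel [measurable]: "T \<in> borel \<rightarrow>\<^sub>M borel" and inv: "distr lborel borel T = lborel"
  shows measurable_lebesgue_if_preserves_lborel: "T \<in> lebesgue \<rightarrow>\<^sub>M lebesgue"
    and distr_lebesgue_if_preserves_lborel: "distr lebesgue lebesgue T = lebesgue"
proof -
  have d: "distr lebesgue lborel T = lborel"
    using inv by (simp add: distr_completion cong: distr_cong)
  then have eq: "null_sets lborel = null_sets (distr lebesgue lborel T)"
    by simp
  show "T \<in> lebesgue \<rightarrow>\<^sub>M lebesgue"
    by (simp add: completion.measurable_completion2 eq measurable_completion)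
  have "distr lebesgue lebesgue T = completion (distr lebesgue lborel T)"
    by (subst completion.completion_distr_eq) (auto simp: eq measurable_completion)
  then show "distr lebesgue lebesgue T = lebesgue"
    by (simp add: d)
qed

lemma
  fixes h :: "complex^'n \<Rightarrow> ennreal"
  assumes u: "\<And>i. norm (u i) = 1" and h: "h \<in> borel_measurable lebesgue"
    and inv: "\<And>z. h (torus_act u z) = h z"
  shows measurable_density_torus_act: "torus_act u \<in> density lebesgue h \<rightarrow>\<^sub>M density lebesgue h"
    and distr_density_torus_act: "distr (density lebesgue h) (density lebesgue h) (torus_act u) = density lebesgue h"
proof -
  note T = measurable_lebesgue_if_preserves_lborel[OF torus_act_measurable distr_lborel_torus_act[OF u]]
     and D = distr_lebesgue_if_preserves_lborel[OF torus_act_measurable distr_lborel_torus_act[OF u]]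
  show m: "torus_act u \<in> density lebesgue h \<rightarrow>\<^sub>M density lebesgue h"
    using T by simp
  show "distr (density lebesgue h) (density lebesgue h) (torus_act u) = density lebesgue h"
  proof (rule measure_eqI)
    fix A assume "A \<in> sets (distr (density lebesgue h) (density lebesgue h) (torus_act u))"
    then have A: "A \<in> sets lebesgue" by simp
    have vA: "torus_act u -` A \<in> sets lebesgue"
      using measurable_sets[OF T A] by simp
    have "emeasure (distr (density lebesgue h) (density lebesgue h) (torus_act u)) A
      = emeasure (density lebesgue h) (torus_act u -` A)"
      using A m by (simp add: emeasure_distr)
    also have "\<dots> = (\<integral>\<^sup>+z. h z * indicator (torus_act u -` A) z \<partial>lebesgue)"
      using vA h by (simp add: emeasure_density)
    also have "\<dots> = (\<integral>\<^sup>+z. h (torus_act u z) * indicator A (torus_act u z) \<partial>lebesgue)"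
      by (intro nn_integral_cong) (auto simp: inv indicator_def)
    also have "\<dots> = (\<integral>\<^sup>+z. h z * indicator A z \<partial>distr lebesgue lebesgue (torus_act u))"
      using T h A by (subst nn_integral_distr) auto
    also have "\<dots> = emeasure (density lebesgue h) A"
      using A h by (simp add: emeasure_density D)
    finally show "emeasure (distr (density lebesgue h) (density lebesgue h) (torus_act u)) A = emeasure (density lebesgue h) A" .
  qed simp
qed

section \<open>Smoothness of the norm of \<open>L\<^sup>p\<close>\<close>

lemma powr_add_le:
  fixes a b p :: real
  assumes "0 \<le> a" "0 \<le> b" "0 \<le> p"
  shows "(a + b) powr p \<le> 2 powr p * (a powr p + b powr p)"
proof -
  have "(a + b) powr p \<le> (2 * max a b) powr p"
    using assms by (intro powr_mono2) auto
  also have "\<dots> = 2 powr p * max a b powr p"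
    using assms by (simp add: powr_mult)
  also have "\<dots> \<le> 2 powr p * (a powr p + b powr p)"
    by (intro mult_left_mono) (auto simp: max_def)
  finally show ?thesis .
qed

lemma integrable_norm_powr_add:
  fixes f g :: "'a \<Rightarrow> complex"
  assumes [measurable]: "f \<in> borel_measurable M" "g \<in> borel_measurable M" and p: "0 \<le> p"
    and "integrable M (\<lambda>z. norm (f z) powr p)" "integrable M (\<lambda>z. norm (g z) powr p)"
  shows "integrable M (\<lambda>z. norm (f z + g z) powr p)"
proof (rule Bochner_Integration.integrable_bound)
  show "integrable M (\<lambda>z. 2 powr p * (norm (f z) powr p + norm (g z) powr p))"
    using assms by simp
  have "norm (f z + g z) powr p \<le> 2 powr p * (norm (f z) powr p + norm (g z) powr p)" for z
    using powr_add_le[of "norm (f z)" "norm (g z)" p] p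
      powr_mono2[OF p, of "norm (f z + g z)" "norm (f z) + norm (g z)"] norm_triangle_ineq[of "f z" "g z"] by simp
  then show "AE z in M. norm (norm (f z + g z) powr p) \<le> norm (2 powr p * (norm (f z) powr p + norm (g z) powr p))"
    by (auto intro: order_trans)
qed simp

lemma Young_powr:
  fixes a b p :: real
  assumes p: "1 < p" and ab: "0 \<le> a" "0 \<le> b"
  shows "a * b powr (p - 1) \<le> a powr p / p + (1 - 1/p) * b powr p"
proof -
  define q where "q = p / (p - 1)"
  have q: "1 < q" "1/p + 1/q = 1" "1/q = 1 - 1/p" "(p - 1) * q = p"
    using p by (auto simp: q_def field_simps)
  have "a * b powr (p - 1) \<le> a powr p / p + (b powr (p - 1)) powr q / q"
    by (rule Youngs_inequality) (use p q ab in auto)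
  also have "(b powr (p - 1)) powr q / q = (1/q) * b powr p"
    by (simp add: powr_powr q(4))
  finally show ?thesis by (simp add: q(3))
qed

lemma borel_measurable_cnj_compose [measurable (raw)]:
  assumes "f \<in> borel_measurable M"
  shows "(\<lambda>z. cnj (f z)) \<in> borel_measurable M"
  using assms by (rule borel_measurable_continuous_on[OF continuous_on_cnj[OF continuous_on_id]])

text \<open>The pointwise size behind duality: since (p - 1)q = p for the conjugate exponent q, the
  q-th power of the right-hand side is |e|^p.\<close>

lemma norm_dual_element:
  fixes e :: complex
  shows "norm (cnj e * of_real (norm e powr (p - 2))) = norm e powr (p - 1)"
  by (cases "e = 0") (simp_all add: norm_mult powr_mult_base)

lemma integrable_dual_pairing:
  fixes f e :: "'a \<Rightarrow> complex"
  assumes [measurable]: "f \<in> borel_measurable M" "e \<in> borel_measurable M" and p: "1 < p"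
    and f: "integrable M (\<lambda>z. norm (f z) powr p)" and e: "integrable M (\<lambda>z. norm (e z) powr p)"
  shows "integrable M (\<lambda>z. f z * (cnj (e z) * of_real (norm (e z) powr (p - 2))))"
proof (rule Bochner_Integration.integrable_bound)
  show "integrable M (\<lambda>z. norm (f z) powr p / p + (1 - 1/p) * norm (e z) powr p)"
    using f e by simp
  have "norm (f z * (cnj (e z) * of_real (norm (e z) powr (p - 2))))
       \<le> norm (f z) powr p / p + (1 - 1/p) * norm (e z) powr p" for z
    unfolding norm_mult[of "f z"] norm_dual_element
    by (rule Young_powr) (use p in auto)
  then show "AE z in M. norm (f z * (cnj (e z) * of_real (norm (e z) powr (p - 2))))
       \<le> norm (norm (f z) powr p / p + (1 - 1/p) * norm (e z) powr p)"
    unfolding real_norm_def by (intro AE_I2 order_trans[OF _ abs_ge_self])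
qed measurable

text \<open>Young's inequality after dividing \<open>f\<close> and \<open>e\<close> by their norms
  \<open>a\<close> and \<open>b\<close>; the two terms then integrate to 1/p + (1 - 1/p) = 1. The
  case \<open>A = 0\<close> is separate because of the division.\<close>

lemma Holder_dual_pairing:
  fixes f e :: "'a \<Rightarrow> complex"
  assumes [measurable]: "f \<in> borel_measurable M" "e \<in> borel_measurable M" and p: "1 < p"
    and f: "integrable M (\<lambda>z. norm (f z) powr p)" and e: "integrable M (\<lambda>z. norm (e z) powr p)"
    and e0: "(\<integral>z. norm (e z) powr p \<partial>M) > 0"
  shows "norm (\<integral>z. f z * (cnj (e z) * of_real (norm (e z) powr (p - 2))) \<partial>M)
     \<le> (\<integral>z. norm (f z) powr p \<partial>M) powr (1/p) * (\<integral>z. norm (e z) powr p \<partial>M) powr (1 - 1/p)"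
proof -
  define A where "A = (\<integral>z. norm (f z) powr p \<partial>M)"
  define B where "B = (\<integral>z. norm (e z) powr p \<partial>M)"
  have B: "B > 0" using e0 by (simp add: B_def)
  have A0: "A \<ge> 0" by (simp add: A_def)
  have int: "norm (\<integral>z. f z * (cnj (e z) * of_real (norm (e z) powr (p - 2))) \<partial>M)
     \<le> (\<integral>z. norm (f z) * norm (e z) powr (p - 1) \<partial>M)"
    using integral_norm_bound[of M "\<lambda>z. f z * (cnj (e z) * of_real (norm (e z) powr (p - 2)))"]
    unfolding norm_mult[of "f _"] norm_dual_element .
  have intg: "integrable M (\<lambda>z. norm (f z) * norm (e z) powr (p - 1))"
    using integrable_norm[OF integrable_dual_pairing[OF assms(1-5)]]
    unfolding norm_mult[of "f _"] norm_dual_element .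
  show ?thesis
  proof (cases "A = 0")
    case True
    then have "AE z in M. norm (f z) powr p = 0"
      using integral_nonneg_eq_0_iff_AE[OF f] by (simp add: A_def)
    then have "AE z in M. f z * (cnj (e z) * of_real (norm (e z) powr (p - 2))) = 0"
      by eventually_elim auto
    then have "(\<integral>z. f z * (cnj (e z) * of_real (norm (e z) powr (p - 2))) \<partial>M) = 0"
      by (intro integral_eq_zero_AE)
    then show ?thesis by simp
  next
    case False
    with A0 have A: "A > 0" by simp
    define a b where "a = A powr (1/p)" and "b = B powr (1/p)"
    have ab: "a > 0" "b > 0" "a powr p = A" "b powr p = B" "b powr (p - 1) = B powr (1 - 1/p)"
      using A B p by (auto simp: a_def b_def powr_powr field_simps)
    have pw: "norm (f z) * norm (e z) powr (p - 1) \<le>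
       a * b powr (p-1) * (norm (f z) powr p / A / p + (1 - 1/p) * (norm (e z) powr p / B))" for z
    proof -
      have "(norm (f z) / a) * (norm (e z) / b) powr (p - 1)
         \<le> (norm (f z) / a) powr p / p + (1 - 1/p) * (norm (e z) / b) powr p"
        by (rule Young_powr) (use p ab in auto)
      then have "(norm (f z) * norm (e z) powr (p - 1)) / (a * b powr (p-1))
         \<le> norm (f z) powr p / A / p + (1 - 1/p) * (norm (e z) powr p / B)"
        using ab by (simp only: powr_divide norm_ge_zero less_imp_le times_divide_times_eq)
      moreover have "0 < a * b powr (p-1)" using ab(1,2) by simp
      ultimately show ?thesis by (simp only: pos_divide_le_eq mult.commute)
    qed
    have "(\<integral>z. norm (f z) * norm (e z) powr (p - 1) \<partial>M)
       \<le> (\<integral>z. a * b powr (p-1) * (norm (f z) powr p / A / p + (1 - 1/p) * (norm (e z) powr p / B)) \<partial>M)"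
      by (rule integral_mono[OF intg _ pw]) (use f e in simp)
    also have "\<dots> = a * b powr (p-1) * (A / A / p + (1 - 1/p) * (B / B))"
      using f e by (simp add: A_def B_def)
    also have "\<dots> = A powr (1/p) * B powr (1 - 1/p)"
      using A B ab by (simp add: a_def)
    finally show ?thesis using int by (simp add: A_def B_def)
  qed
qed

text \<open>Mean value theorem. The common bound \<open>c\<close> yields a majorant for difference
  quotients that is independent of the step.\<close>

lemma powr_diff_le:
  fixes x y p :: real
  assumes "0 \<le> x" "0 \<le> y" "1 < p" "x \<le> c" "y \<le> c"
  shows "\<bar>x powr p - y powr p\<bar> \<le> p * c powr (p - 1) * \<bar>x - y\<bar>"
proof -
  have *: "y powr p - x powr p \<le> p * c powr (p - 1) * (y - x)" if "0 \<le> x" "x < y" "y \<le> c" for x y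
  proof -
    note xy = that
    have "continuous_on {x..y} (\<lambda>t. t powr p)"
      using assms that by (intro continuous_on_powr' continuous_intros) auto
    then obtain l t where t: "x < t" "t < y" "DERIV (\<lambda>t. t powr p) t :> l" "y powr p - x powr p = (y - x) * l"
      using MVT[of x y "\<lambda>t. t powr p"] xy has_real_derivative_powr[of _ p]
      unfolding real_differentiable_def by (smt (verit))
    have "l = p * t powr (p - 1)"
      using DERIV_unique[OF t(3) has_real_derivative_powr] t that by auto
    then show ?thesis
      using t that assms by (auto simp: mult.commute intro!: mult_left_mono powr_mono2)
  qed
  have "x powr p < y powr p" if "x < y" using that assms by (intro powr_less_mono2) auto
  moreover have "y powr p < x powr p" if "y < x" using that assms by (intro powr_less_mono2) auto
  ultimately show ?thesis using *[of x y] *[of y x] assms by (cases x y rule: linorder_cases) auto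
qed

text \<open>For \<open>a\<close> nonzero the squared norm is a polynomial in the step, and the chain
  rule handles the outer exponent p/2. At \<open>a = 0\<close> the norm need not be differentiable,
  but the quotient equals t^(p-1)|b|^p with step t and vanishes in the limit because p > 1.\<close>

lemma tendsto_norm_powr_difference_quotient:
  fixes a b :: complex
  assumes p: "1 < p"
  shows "(\<lambda>n. real (Suc n) * (norm (a + of_real (1 / real (Suc n)) * b) powr p - norm a powr p))
     \<longlonglongrightarrow> p * Re (b * (cnj a * of_real (norm a powr (p - 2))))"
proof -
  have lim0: "(\<lambda>n. 1 / real (Suc n)) \<longlonglongrightarrow> 0"
    using LIMSEQ_inverse_real_of_nat by (simp add: inverse_eq_divide)
  show ?thesis
  proof (cases "a = 0")
    case True
    have "(\<lambda>n. (1 / real (Suc n)) powr (p - 1) * norm b powr p) \<longlonglongrightarrow> 0 * norm b powr p"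
      using p by (intro tendsto_intros lim0) 
        (use tendsto_powr'[OF lim0 tendsto_const, of "p - 1"] in auto)
    moreover have "real (Suc n) * (norm (a + of_real (1 / real (Suc n)) * b) powr p - norm a powr p)
       = (1 / real (Suc n)) powr (p - 1) * norm b powr p" for n
      using True p by (simp add: norm_mult powr_mult powr_diff powr_divide norm_divide field_simps del: of_nat_Suc)
    ultimately show ?thesis using True by simp
  next
    case False
    have "((\<lambda>s::real. (norm (a + of_real s * b))\<^sup>2) has_real_derivative 2 * Re (b * cnj a)) (at 0)"
      unfolding cmod_power2 by (auto intro!: derivative_eq_intros simp: algebra_simps)
    then have "((\<lambda>s::real. ((norm (a + of_real s * b))\<^sup>2) powr (p/2)) has_real_derivative
        (p/2) * ((norm a)\<^sup>2) powr (p/2 - 1) * (2 * Re (b * cnj a))) (at 0)"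
      using has_real_derivative_powr[of "(norm a)\<^sup>2" "p/2"] False
      by (intro DERIV_chain2[where f="\<lambda>t. t powr (p/2)" and g="\<lambda>s. (norm (a + of_real s * b))\<^sup>2"]) simp_all
    moreover have "(x\<^sup>2) powr r = x powr (2 * r)" if "x \<ge> 0" for x r :: real
      using that by (cases "x = 0") (auto simp: powr_powr simp flip: powr_numeral)
    ultimately have "((\<lambda>s::real. norm (a + of_real s * b) powr p) has_real_derivative
        p * Re (b * (cnj a * of_real (norm a powr (p - 2))))) (at 0)"
      by (simp add: algebra_simps)
    then have "((\<lambda>s. (norm (a + of_real s * b) powr p - norm a powr p) / s) \<longlongrightarrow>
        p * Re (b * (cnj a * of_real (norm a powr (p - 2))))) (at 0)"
      by (simp add: DERIV_def)
    moreover have "filterlim (\<lambda>n. 1 / real (Suc n)) (at 0) sequentially"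
      using lim0 by (intro filterlim_atI) auto
    ultimately have "(\<lambda>n. (norm (a + of_real (1 / real (Suc n)) * b) powr p - norm a powr p) / (1 / real (Suc n)))
       \<longlonglongrightarrow> p * Re (b * (cnj a * of_real (norm a powr (p - 2))))"
      by (rule filterlim_compose)
    then show ?thesis by (simp add: mult.commute)
  qed
qed

text \<open>Differentiation under the integral sign, along the steps 1/(n+1) so that dominated
  convergence for sequences applies. With c = |e| + |h| every quotient is at most p c^(p-1) |h|
  \<le> p c^p, which \<open>powr_add_le\<close> makes integrable.\<close>

lemma tendsto_integral_powr_difference_quotient:
  fixes e h :: "'a \<Rightarrow> complex"
  assumes [measurable]: "h \<in> borel_measurable M" "e \<in> borel_measurable M" and p: "1 < p"
    and h: "integrable M (\<lambda>z. norm (h z) powr p)" and e: "integrable M (\<lambda>z. norm (e z) powr p)"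
  shows "(\<lambda>n. real (Suc n) * ((\<integral>z. norm (e z + of_real (1 / real (Suc n)) * h z) powr p \<partial>M) - (\<integral>z. norm (e z) powr p \<partial>M)))
     \<longlonglongrightarrow> p * Re (\<integral>z. h z * (cnj (e z) * of_real (norm (e z) powr (p - 2))) \<partial>M)"
proof -
  let ?D = "\<lambda>n z. real (Suc n) * (norm (e z + of_real (1 / real (Suc n)) * h z) powr p - norm (e z) powr p)"
  let ?w = "\<lambda>z. p * 2 powr p * (norm (e z) powr p + norm (h z) powr p)"
  have pair: "integrable M (\<lambda>z. h z * (cnj (e z) * of_real (norm (e z) powr (p - 2))))"
    by (rule integrable_dual_pairing) (use assms in auto)
  have intn: "integrable M (\<lambda>z. norm (e z + of_real (1 / real (Suc n)) * h z) powr p)" for n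
  proof (rule integrable_norm_powr_add)
    have "integrable M (\<lambda>z. norm (complex_of_real (1 / real (Suc n))) powr p * norm (h z) powr p)"
      using h by simp
    then show "integrable M (\<lambda>z. norm (of_real (1 / real (Suc n)) * h z) powr p)"
      unfolding norm_mult by (simp only: powr_mult norm_ge_zero)
  qed (use assms in auto)
  have bound: "norm (?D n z) \<le> ?w z" for n z
  proof -
    define c where "c = norm (e z) + norm (h z)"
    define s where "s = 1 / real (Suc n)"
    have s: "0 < s" "s \<le> 1" "real (Suc n) = 1 / s" by (auto simp: s_def)
    have n1: "norm (of_real s * h z) = s * norm (h z)" using s by (simp add: norm_mult)
    have "s * norm (h z) \<le> norm (h z)" using s by (simp add: mult_left_le_one_le)
    then have *: "norm (e z + of_real s * h z) \<le> c"
      using norm_triangle_ineq[of "e z" "of_real s * h z"] n1 by (simp add: c_def)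
    have "\<bar>norm (e z + of_real s * h z) powr p - norm (e z) powr p\<bar>
      \<le> p * c powr (p - 1) * \<bar>norm (e z + of_real s * h z) - norm (e z)\<bar>"
      by (rule powr_diff_le) (use p * in \<open>auto simp: c_def\<close>)
    also have "\<bar>norm (e z + of_real s * h z) - norm (e z)\<bar> \<le> s * norm (h z)"
      using norm_triangle_ineq3[of "e z + of_real s * h z" "e z"] n1 by simp
    also have "s * norm (h z) \<le> s * c" using s by (simp add: c_def)
    finally have "\<bar>norm (e z + of_real s * h z) powr p - norm (e z) powr p\<bar> \<le> p * c powr (p - 1) * (s * c)"
      using p by (simp add: mult_left_mono)
    also have "\<dots> = s * (p * c powr p)"
      using powr_mult_base[of c "p - 1"] by (simp add: c_def mult_ac)
    finally have "\<bar>norm (e z + of_real s * h z) powr p - norm (e z) powr p\<bar> / s \<le> p * c powr p"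
      using s by (simp add: pos_divide_le_eq mult.commute)
    then have "norm (?D n z) \<le> p * c powr p"
      using s unfolding s_def[symmetric] s(3) by (simp add: abs_mult)
    also have "\<dots> \<le> ?w z"
      using powr_add_le[of "norm (e z)" "norm (h z)" p] p by (simp add: c_def)
    finally show ?thesis .
  qed
  have "(\<lambda>n. \<integral>z. ?D n z \<partial>M) \<longlonglongrightarrow> (\<integral>z. p * Re (h z * (cnj (e z) * of_real (norm (e z) powr (p - 2)))) \<partial>M)"
  proof (rule integral_dominated_convergence[where w="?w"])
    show "integrable M ?w" using e h by simp
    show "AE z in M. (\<lambda>n. ?D n z) \<longlonglongrightarrow> p * Re (h z * (cnj (e z) * of_real (norm (e z) powr (p - 2))))"
      using tendsto_norm_powr_difference_quotient[OF p] by simp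
    show "AE z in M. norm (?D n z) \<le> ?w z" for n
      using bound by simp
  qed simp_all
  moreover have "(\<integral>z. ?D n z \<partial>M) = real (Suc n) * ((\<integral>z. norm (e z + of_real (1 / real (Suc n)) * h z) powr p \<partial>M) - (\<integral>z. norm (e z) powr p \<partial>M))" for n
    using intn[of n] e by (simp add: Bochner_Integration.integral_diff del: of_nat_Suc)
  moreover have "(\<integral>z. p * Re (h z * (cnj (e z) * of_real (norm (e z) powr (p - 2)))) \<partial>M)
    = p * Re (\<integral>z. h z * (cnj (e z) * of_real (norm (e z) powr (p - 2))) \<partial>M)"
    using pair by (simp only: integral_mult_right_zero integral_Re)
  ultimately show ?thesis by (simp only:)
qed

text \<open>Smoothness of the \<open>L\<^sup>p\<close> norm at \<open>e\<close>: a functional of norm \<open>1 / \<parallel>e\<parallel>\<close> with value 1 at \<open>e\<close>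
  annihilates every direction in which the norm has vanishing derivative.\<close>
lemma norming_functional_vanishes:
  fixes e h :: "'a \<Rightarrow> complex" and \<kappa> :: real
  assumes "h \<in> borel_measurable M" "e \<in> borel_measurable M" and p: "1 < p"
    and "integrable M (\<lambda>z. norm (h z) powr p)" "integrable M (\<lambda>z. norm (e z) powr p)"
    and e0: "(\<integral>z. norm (e z) powr p \<partial>M) > 0"
    and orth: "(\<integral>z. h z * (cnj (e z) * of_real (norm (e z) powr (p - 2))) \<partial>M) = 0"
    and \<kappa>: "0 \<le> \<kappa>"
    and le: "\<And>n. (1 + \<kappa> / real (Suc n)) powr p * (\<integral>z. norm (e z) powr p \<partial>M)
              \<le> (\<integral>z. norm (e z + of_real (1 / real (Suc n)) * h z) powr p \<partial>M)"
  shows "\<kappa> = 0"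
proof -
  define I where "I = (\<integral>z. norm (e z) powr p \<partial>M)"
  \<comment> \<open>Since x \<le> x^p for x \<ge> 1, the hypothesis \<open>le\<close> gives growth
    at least linear in the step, whereas the derivative in direction \<open>h\<close> is 0 by
    \<open>orth\<close>.\<close>
  have "\<kappa> * I \<le> real (Suc n) * ((\<integral>z. norm (e z + of_real (1 / real (Suc n)) * h z) powr p \<partial>M) - I)" for n
  proof -
    have "1 + \<kappa> / real (Suc n) \<le> (1 + \<kappa> / real (Suc n)) powr p"
      using powr_mono[of 1 p "1 + \<kappa> / real (Suc n)"] p \<kappa> by simp
    then have "(1 + \<kappa> / real (Suc n)) * I \<le> (1 + \<kappa> / real (Suc n)) powr p * I"
      using e0 by (intro mult_right_mono) (auto simp: I_def)
    then have "(1 + \<kappa> / real (Suc n)) * I \<le> (\<integral>z. norm (e z + of_real (1 / real (Suc n)) * h z) powr p \<partial>M)"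
      using le[of n] unfolding I_def by (rule order_trans)
    then show ?thesis by (simp add: field_simps del: of_real_divide of_real_of_nat_eq)
  qed
  moreover have "(\<lambda>n. real (Suc n) * ((\<integral>z. norm (e z + of_real (1 / real (Suc n)) * h z) powr p \<partial>M) - I)) \<longlonglongrightarrow> 0"
    using tendsto_integral_powr_difference_quotient[OF assms(1-5)] orth by (simp add: I_def)
  ultimately have "\<kappa> * I \<le> 0"
    by (intro LIMSEQ_le_const) auto
  then show ?thesis using e0 \<kappa> by (simp add: I_def mult_le_0_iff)
qed

section \<open>Monomials\<close>

lemma borel_measurable_powi_nth [measurable]:
  "(\<lambda>z::complex^'n. (z$j) powi k) \<in> borel_measurable borel"
proof -
  have [measurable]: "(\<lambda>z::complex^'n. z$j) \<in> borel_measurable borel"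
    by (intro borel_measurable_continuous_onI continuous_intros)
  show ?thesis unfolding power_int_def by (cases "k \<ge> 0") simp_all
qed

lemma borel_measurable_monom [measurable]: "monom \<alpha> \<in> borel_measurable borel"
  unfolding monom_def by measurable

lemma borel_measurable_monom_lebesgue: "monom \<alpha> \<in> borel_measurable lebesgue"
  using measurable_completion[of "monom \<alpha>" lborel borel] by simp

lemma monom_torus_act: "monom \<alpha> (torus_act u z) = (\<Prod>j\<in>UNIV. u j powi \<alpha> j) * monom \<alpha> z"
  by (simp add: monom_def torus_act_def power_int_mult_distrib prod.distrib)

lemma norm_powi_eq_one: "norm (u::complex) = 1 \<Longrightarrow> norm (u powi k) = 1"
  by (simp add: norm_power_int)

text \<open>Rotating a single coordinate, in which the exponents differ by \<open>m\<close>, by the angle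
  \<open>\<pi> / (2 m)\<close> multiplies the integral by the imaginary unit.\<close>
lemma monom_orthogonal:
  fixes h :: "complex^'n \<Rightarrow> ennreal"
  assumes h: "h \<in> borel_measurable lebesgue"
    and inv: "\<And>u z. (\<And>i. norm (u i) = 1) \<Longrightarrow> h (torus_act u z) = h z"
    and ne: "\<alpha> \<noteq> \<beta>"
  shows "(\<integral>z. monom \<beta> z * (cnj (monom \<alpha> z) * of_real (norm (monom \<alpha> z) powr r)) \<partial>density lebesgue h) = 0"
proof -
  obtain j where j: "\<alpha> j \<noteq> \<beta> j" using ne by auto
  define m where "m = \<beta> j - \<alpha> j"
  have m0: "m \<noteq> 0" using j by (simp add: m_def)
  define c where "c = cis (pi / (2 * of_int m))"
  define u where "u i = (if i = j then c else 1)" for i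
  have u: "norm (u i) = 1" for i by (simp add: u_def c_def)
  have up: "(\<Prod>i\<in>UNIV. u i powi \<gamma> i) = c powi \<gamma> j" for \<gamma> :: "'n \<Rightarrow> int"
  proof -
    have "(\<Prod>i\<in>UNIV. u i powi \<gamma> i) = (\<Prod>i\<in>UNIV. if i = j then c powi \<gamma> i else 1)"
      by (rule prod.cong) (auto simp: u_def)
    then show ?thesis by simp
  qed
  have nc: "norm c = 1" "c \<noteq> 0" by (auto simp: c_def)
  define F where "F z = monom \<beta> z * (cnj (monom \<alpha> z) * of_real (norm (monom \<alpha> z) powr r))" for z
  note [measurable] = borel_measurable_monom_lebesgue
  have Fm: "F \<in> borel_measurable (density lebesgue h)"
    unfolding F_def measurable_density_eq1 by measurable
  have "c powi \<beta> j * cnj (c powi \<alpha> j) = c powi m"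
  proof -
    have "cnj c = inverse c" by (simp add: c_def cis_cnj cis_inverse)
    then show ?thesis using nc by (simp add: m_def power_int_diff power_int_inverse divide_inverse)
  qed
  also have "\<dots> = \<i>"
    using m0 by (simp add: c_def cis_power_int)
  finally have cc: "c powi \<beta> j * cnj (c powi \<alpha> j) = \<i>" .
  have FT: "F (torus_act u z) = \<i> * F z" for z
  proof -
    have "F (torus_act u z) = (c powi \<beta> j * cnj (c powi \<alpha> j)) * F z"
      unfolding F_def monom_torus_act up by (simp add: norm_mult norm_powi_eq_one nc)
    then show ?thesis by (simp only: cc)
  qed
  have "(\<integral>z. F z \<partial>density lebesgue h) = (\<integral>z. F z \<partial>distr (density lebesgue h) (density lebesgue h) (torus_act u))"
    by (simp add: distr_density_torus_act[OF u h inv[OF u]])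
  also have "\<dots> = (\<integral>z. F (torus_act u z) \<partial>density lebesgue h)"
    by (rule integral_distr[OF measurable_density_torus_act[OF u h inv[OF u]] Fm])
  also have "\<dots> = \<i> * (\<integral>z. F z \<partial>density lebesgue h)"
    by (simp add: FT)
  finally have "(1 - \<i>) * (\<integral>z. F z \<partial>density lebesgue h) = 0"
    by (simp add: algebra_simps)
  moreover have "1 - \<i> \<noteq> 0" by (simp add: complex_eq_iff)
  ultimately show ?thesis unfolding F_def by simp
qed

section \<open>Geometric majorants and polydiscs\<close>

lemma sum_geometric_int_le:
  fixes \<rho> :: real
  assumes "0 \<le> \<rho>" "\<rho> < 1"
  shows "(\<Sum>k\<in>{- int N..int N}. \<rho> ^ nat \<bar>k\<bar>) \<le> 2 / (1 - \<rho>)"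
proof -
  have g: "(\<Sum>i\<le>N. \<rho> ^ i) \<le> 1 / (1 - \<rho>)"
    using sum_le_suminf[of "\<lambda>i. \<rho> ^ i" "{..N}"] assms by (simp add: suminf_geometric summable_geometric)
  have "{- int N..int N} = int ` {..N} \<union> (\<lambda>i. - int i) ` {..N}"
  proof (intro equalityI subsetI)
    fix k assume k: "k \<in> {- int N..int N}"
    show "k \<in> int ` {..N} \<union> (\<lambda>i. - int i) ` {..N}"
    proof (cases "k \<ge> 0")
      case True then show ?thesis using k by (intro UnI1 image_eqI[of _ _ "nat k"]) auto
    next
      case False then show ?thesis using k by (intro UnI2 image_eqI[of _ _ "nat (- k)"]) auto
    qed
  qed auto
  then have "(\<Sum>k\<in>{- int N..int N}. \<rho> ^ nat \<bar>k\<bar>)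
     \<le> (\<Sum>k\<in>int ` {..N}. \<rho> ^ nat \<bar>k\<bar>) + (\<Sum>k\<in>(\<lambda>i. - int i) ` {..N}. \<rho> ^ nat \<bar>k\<bar>)"
    using assms by (simp add: sum_Un sum_nonneg)
  also have "\<dots> = (\<Sum>i\<le>N. \<rho> ^ i) + (\<Sum>i\<le>N. \<rho> ^ i)"
    by (subst (1 2) sum.reindex) (auto simp: inj_on_def)
  finally show ?thesis using g by simp
qed

text \<open>Every finite set of exponents fits into a cube, over which the sum of products factors
  into one-dimensional sums; each of these is bounded independently of the size of the cube.\<close>

lemma summable_on_prod_geometric:
  fixes \<rho> :: "'n::finite \<Rightarrow> real"
  assumes "\<And>j. 0 \<le> \<rho> j" "\<And>j. \<rho> j < 1"
  shows "(\<lambda>\<alpha>::'n \<Rightarrow> int. \<Prod>j\<in>UNIV. \<rho> j ^ nat \<bar>\<alpha> j\<bar>) summable_on UNIV"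
proof (rule nonneg_bdd_above_summable_on)
  show "bdd_above (sum (\<lambda>\<alpha>::'n \<Rightarrow> int. \<Prod>j\<in>UNIV. \<rho> j ^ nat \<bar>\<alpha> j\<bar>) ` {F. F \<subseteq> UNIV \<and> finite F})"
  proof (rule bdd_aboveI2)
    fix F :: "('n \<Rightarrow> int) set" assume "F \<in> {F. F \<subseteq> UNIV \<and> finite F}"
    then have F: "finite F" by simp
    then have "finite ((\<lambda>(\<alpha>,j). nat \<bar>\<alpha> j\<bar>) ` (F \<times> UNIV))" by simp
    then obtain N where "\<forall>n\<in>(\<lambda>(\<alpha>,j). nat \<bar>\<alpha> j\<bar>) ` (F \<times> UNIV). n \<le> N"
      unfolding finite_nat_set_iff_bounded_le by blast
    then have N: "nat \<bar>\<alpha> j\<bar> \<le> N" if "\<alpha> \<in> F" for \<alpha> j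
      using that by fastforce
    have sub: "F \<subseteq> (\<Pi>\<^sub>E j\<in>UNIV. {- int N..int N})"
    proof
      fix \<alpha> assume "\<alpha> \<in> F"
      then have "\<alpha> j \<in> {- int N..int N}" for j
        using N[of \<alpha> j] by auto
      then show "\<alpha> \<in> (\<Pi>\<^sub>E j\<in>UNIV. {- int N..int N})" by auto
    qed
    have "(\<Sum>\<alpha>\<in>F. \<Prod>j\<in>UNIV. \<rho> j ^ nat \<bar>\<alpha> j\<bar>) \<le> (\<Sum>\<alpha>\<in>(\<Pi>\<^sub>E j\<in>UNIV. {- int N..int N}). \<Prod>j\<in>UNIV. \<rho> j ^ nat \<bar>\<alpha> j\<bar>)"
      using assms by (intro sum_mono2 sub) (auto intro!: finite_PiE prod_nonneg)
    also have "\<dots> = (\<Prod>j\<in>UNIV. \<Sum>k\<in>{- int N..int N}. \<rho> j ^ nat \<bar>k\<bar>)"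
      by (subst prod_sum_PiE) auto
    also have "\<dots> \<le> (\<Prod>j\<in>UNIV. 2 / (1 - \<rho> j))"
      using assms by (intro prod_mono conjI sum_geometric_int_le sum_nonneg) auto
    finally show "(\<Sum>\<alpha>\<in>F. \<Prod>j\<in>UNIV. \<rho> j ^ nat \<bar>\<alpha> j\<bar>) \<le> (\<Prod>j\<in>UNIV. 2 / (1 - \<rho> j))" .
  qed
qed (use assms in \<open>auto intro!: prod_nonneg\<close>)

text \<open>The gain in one variable: for \<open>z\<close> near \<open>a\<close>, moving to a point
  \<open>t\<close> of the larger disc, outwards for nonnegative \<open>k\<close> and inwards for
  negative \<open>k\<close>, improves |z^k| by a geometric factor. The point \<open>t\<close> may
  depend on \<open>k\<close>, but the radius and the ratio may not. At \<open>a = 0\<close> there is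
  no room to move inwards, hence the restriction on \<open>k\<close>.\<close>

lemma powi_geometric_bound:
  fixes a :: complex
  assumes "0 < \<delta>"
  shows "\<exists>\<eta> \<rho>. 0 < \<eta> \<and> 0 \<le> \<rho> \<and> \<rho> < 1 \<and> (\<forall>k. a \<noteq> 0 \<or> 0 \<le> k \<longrightarrow>
     (\<exists>t\<in>cball a \<delta>. \<forall>z\<in>cball a \<eta>. norm (z powi k) \<le> \<rho> ^ nat \<bar>k\<bar> * norm (t powi k)))"
proof (cases "a = 0")
  case True
  show ?thesis
  proof (rule exI[of _ "\<delta>/2"], rule exI[of _ "1/2"], intro conjI allI impI)
    fix k :: int assume "a \<noteq> 0 \<or> 0 \<le> k"
    then have k: "k \<ge> 0" using True by simp
    then obtain n where n: "k = int n" using nonneg_int_cases by blast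
    show "\<exists>t\<in>cball a \<delta>. \<forall>z\<in>cball a (\<delta>/2). norm (z powi k) \<le> (1/2) ^ nat \<bar>k\<bar> * norm (t powi k)"
    proof (intro bexI[of _ "of_real \<delta>"] ballI)
      fix z assume "z \<in> cball a (\<delta>/2)"
      then have "norm z ^ n \<le> (1/2 * \<delta>) ^ n" using True by (intro power_mono) auto
      then show "norm (z powi k) \<le> (1/2) ^ nat \<bar>k\<bar> * norm (complex_of_real \<delta> powi k)"
        using assms by (simp add: n norm_power power_divide)
    qed (use True assms in auto)
  qed (use assms in auto)
next
  case False
  define r where "r = norm a"
  have r: "r > 0" using False by (simp add: r_def)
  \<comment> \<open>The bound r/2 keeps the disc of radius \<open>d\<close> about \<open>a\<close>
    away from 0.\<close>
  define d where "d = min \<delta> (r/2)"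
  have d: "0 < d" "d \<le> \<delta>" "d < r" using assms r by (auto simp: d_def)
  \<comment> \<open>The first quotient compares the largest modulus on the disc of radius d/2 with
    that of the outer point, the second compares the modulus of the inner point with the smallest
    modulus on the small disc.\<close>
  define \<rho> where "\<rho> = max ((r + d/2) / (r + d)) ((r - d) / (r - d/2))"
  have \<rho>1: "r + d/2 \<le> \<rho> * (r + d)"
    using d r by (simp add: \<rho>_def pos_divide_le_eq[symmetric])
  have \<rho>2: "r - d \<le> \<rho> * (r - d/2)"
    using d r by (simp add: \<rho>_def pos_divide_le_eq[symmetric])
  have \<rho>: "0 \<le> \<rho>" "\<rho> < 1" using d r by (auto simp: \<rho>_def max_def)
  show ?thesis
  proof (rule exI[of _ "d/2"], rule exI[of _ \<rho>], intro conjI allI impI)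
    fix k :: int
    show "\<exists>t\<in>cball a \<delta>. \<forall>z\<in>cball a (d/2). norm (z powi k) \<le> \<rho> ^ nat \<bar>k\<bar> * norm (t powi k)"
    proof (cases "k \<ge> 0")
      case True
      then obtain n where n: "k = int n" using nonneg_int_cases by blast
      define t where "t = a * of_real (1 + d / r)"
      have "norm t = r * (1 + d / r)"
        unfolding t_def norm_mult norm_of_real r_def[symmetric] using d r by simp
      then have "norm t = r + d" using r by (simp add: distrib_left)
      moreover have "a - t = - (a * of_real (d / r))" by (simp add: t_def algebra_simps)
      then have "dist a t = r * \<bar>d / r\<bar>"
        unfolding dist_norm by (simp only: norm_minus_cancel norm_mult norm_of_real r_def)
      then have "dist a t = d" using d r by simp
      moreover have "norm z ^ n \<le> (\<rho> * (r + d)) ^ n" if "z \<in> cball a (d/2)" for z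
      proof (rule power_mono)
        have "norm z \<le> r + d/2" using that norm_triangle_ineq2[of z a] by (simp add: dist_norm norm_minus_commute r_def)
        then show "norm z \<le> \<rho> * (r + d)" using \<rho>1 by simp
      qed simp
      ultimately show ?thesis
        using d by (intro bexI[of _ t]) (auto simp: n norm_power power_mult_distrib)
    next
      case False
      then obtain n where n: "k = - int n" by (metis int_cases2 of_nat_0_le_iff)
      define t where "t = a * of_real (1 - d / r)"
      have "1 - d / r \<ge> 0" using d r by (simp add: field_simps)
      then have "norm t = r * (1 - d / r)"
        unfolding t_def norm_mult norm_of_real r_def[symmetric] by simp
      then have t: "norm t = r - d" using r by (simp add: right_diff_distrib)
      have "a - t = a * of_real (d / r)" by (simp add: t_def algebra_simps)
      then have "dist a t = r * \<bar>d / r\<bar>"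
        unfolding dist_norm by (simp only: norm_mult norm_of_real r_def)
      then have dt: "dist a t = d" using d r by simp
      have "norm (z powi k) \<le> \<rho> ^ nat \<bar>k\<bar> * norm (t powi k)" if "z \<in> cball a (d/2)" for z
      proof -
        have z: "norm z \<ge> r - d/2" using that norm_triangle_ineq2[of a z] by (simp add: dist_norm r_def)
        have "norm t \<le> \<rho> * norm z"
          using \<rho>2 mult_left_mono[OF z \<rho>(1)] t by simp
        then have "norm t ^ n \<le> \<rho> ^ n * norm z ^ n"
          using power_mono[of "norm t" "\<rho> * norm z" n] by (simp add: power_mult_distrib)
        moreover have "norm z > 0" "norm t > 0" using z d r t by auto
        ultimately have "inverse (norm z ^ n) \<le> \<rho> ^ n * inverse (norm t ^ n)"
          by (simp add: field_simps)
        then show ?thesis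
          by (simp add: n power_int_minus norm_inverse norm_power)
      qed
      then show ?thesis using d dt by (intro bexI[of _ t]) auto
    qed
  qed (use d \<rho> in auto)
qed

lemma closed_polydisc_subset:
  fixes a :: "complex^'n"
  assumes "open \<Omega>" "a \<in> \<Omega>"
  shows "\<exists>\<delta>>0. {z. \<forall>j. z$j \<in> cball (a$j) \<delta>} \<subseteq> \<Omega>"
proof -
  obtain e where e: "e > 0" "ball a e \<subseteq> \<Omega>"
    using assms open_contains_ball by blast
  \<comment> \<open>The distance is at most the sum of the coordinate distances, here at most
    e/2.\<close>
  define \<delta> where "\<delta> = e / (2 * real CARD('n))"
  have "dist a z < e" if "\<forall>j. z$j \<in> cball (a$j) \<delta>" for z
  proof -
    have "dist a z \<le> (\<Sum>j\<in>UNIV. dist (a$j) (z$j))"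
      unfolding dist_vec_def by (rule L2_set_le_sum) simp
    also have "\<dots> \<le> (\<Sum>j\<in>(UNIV::'n set). \<delta>)"
      using that by (intro sum_mono) auto
    also have "\<dots> = e/2" by (simp add: \<delta>_def)
    finally show ?thesis using e by simp
  qed
  then show ?thesis using e by (intro exI[of _ \<delta>]) (auto simp: \<delta>_def)
qed

lemma compact_polydisc: "compact {z::complex^'n. \<forall>j. z$j \<in> cball (a$j) \<delta>}"
proof -
  have "closed {z::complex^'n. \<forall>j. z$j \<in> cball (a$j) \<delta>}"
    unfolding mem_cball by (intro closed_Collect_all closed_Collect_le continuous_intros)
  moreover have "bounded {z::complex^'n. \<forall>j. z$j \<in> cball (a$j) \<delta>}"
  proof (rule boundedI)
    fix z :: "complex^'n" assume z: "z \<in> {z. \<forall>j. z$j \<in> cball (a$j) \<delta>}"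
    have "norm (z$j) \<le> norm (a$j) + \<delta>" for j
      using z norm_triangle_ineq2[of "z$j" "a$j"] by (simp add: dist_norm norm_minus_commute) (smt (verit))
    then show "norm z \<le> (\<Sum>j\<in>UNIV. norm (a$j) + \<delta>)"
      unfolding norm_vec_def by (intro order_trans[OF L2_set_le_sum] sum_mono) auto
  qed
  ultimately show ?thesis by (simp add: compact_eq_bounded_closed)
qed

lemma nonzero_in_cball:
  fixes a :: complex assumes "0 < \<delta>" shows "\<exists>t\<in>cball a \<delta>. t \<noteq> 0"
proof (cases "a = 0")
  case True then show ?thesis using assms by (intro bexI[of _ "of_real \<delta>"]) auto
next
  case False then show ?thesis using assms by (intro bexI[of _ a]) auto
qed

text \<open>Supplies a base point at which no monomial vanishes, whatever the signs of its
  exponents.\<close>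

lemma open_has_nonzero_coordinates:
  fixes \<Omega> :: "(complex^'n) set"
  assumes "open \<Omega>" "\<Omega> \<noteq> {}"
  shows "\<exists>a\<in>\<Omega>. \<forall>j. a$j \<noteq> 0"
proof -
  obtain a where "a \<in> \<Omega>" using assms by auto
  then obtain \<delta> where \<delta>: "\<delta> > 0" "{z. \<forall>j. z$j \<in> cball (a$j) \<delta>} \<subseteq> \<Omega>"
    using closed_polydisc_subset assms by blast
  have "\<forall>j. \<exists>t. t \<in> cball (a$j) \<delta> \<and> t \<noteq> 0"
    using nonzero_in_cball[OF \<delta>(1)] by blast
  then obtain t where "\<And>j. t j \<in> cball (a$j) \<delta> \<and> t j \<noteq> 0"
    by metis
  then show ?thesis using \<delta> by (intro bexI[of _ "\<chi> j. t j"]) auto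
qed

section \<open>Spaces of \<open>p\<close>-integrable functions and Laurent series\<close>

lemma wmeasure_measurable_iff: "f \<in> borel_measurable (wmeasure \<Omega> wt) \<longleftrightarrow> f \<in> borel_measurable lebesgue"
  by (simp add: wmeasure_def)

lemma nn_integral_finite_iff_integrable_powr:
  fixes f :: "'a \<Rightarrow> complex"
  assumes [measurable]: "f \<in> borel_measurable M"
  shows "(\<integral>\<^sup>+ z. ennreal (norm (f z) powr p) \<partial>M) < \<infinity> \<longleftrightarrow> integrable M (\<lambda>z. norm (f z) powr p)"
  by (simp add: integrable_iff_bounded)

lemma mem_Lp_space_iff:
  "f \<in> Lp_space \<Omega> wt p \<longleftrightarrow> f \<in> borel_measurable (wmeasure \<Omega> wt) \<and> integrable (wmeasure \<Omega> wt) (\<lambda>z. norm (f z) powr p)"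
  unfolding Lp_space_def using nn_integral_finite_iff_integrable_powr by blast

lemma Lpnorm_eq_integral:
  assumes "f \<in> Lp_space \<Omega> wt p"
  shows "Lpnorm \<Omega> wt p f = (\<integral>z. norm (f z) powr p \<partial>wmeasure \<Omega> wt) powr (1/p)"
  using assms unfolding Lpnorm_def mem_Lp_space_iff
  by (subst integral_eq_nn_integral) auto

lemma Lp_space_add:
  assumes "f \<in> Lp_space \<Omega> wt p" "g \<in> Lp_space \<Omega> wt p" "0 \<le> p"
  shows "(\<lambda>z. f z + g z) \<in> Lp_space \<Omega> wt p"
  using assms unfolding mem_Lp_space_iff by (auto intro: integrable_norm_powr_add)

lemma Lp_space_cmult:
  assumes "f \<in> Lp_space \<Omega> wt p"
  shows "(\<lambda>z. c * f z) \<in> Lp_space \<Omega> wt p"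
  using assms unfolding mem_Lp_space_iff by (auto simp: norm_mult powr_mult)

lemma Lp_space_zero: "(\<lambda>z. 0) \<in> Lp_space \<Omega> wt p"
  unfolding mem_Lp_space_iff by simp

lemma Lp_space_sum:
  assumes "\<And>i. i \<in> I \<Longrightarrow> f i \<in> Lp_space \<Omega> wt p" "0 \<le> p"
  shows "(\<lambda>z. \<Sum>i\<in>I. f i z) \<in> Lp_space \<Omega> wt p"
  using assms by (induction I rule: infinite_finite_induct) (auto intro: Lp_space_add Lp_space_zero)

lemma holo_n_add:
  assumes "holo_n \<Omega> f" "holo_n \<Omega> g" shows "holo_n \<Omega> (\<lambda>z. f z + g z)"
  unfolding holo_n_def
proof
  fix z assume "z \<in> \<Omega>"
  then obtain L L' where "(f has_derivative L) (at z)" "\<forall>c v. L (c *s v) = c * L v"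
      "(g has_derivative L') (at z)" "\<forall>c v. L' (c *s v) = c * L' v"
    using assms unfolding holo_n_def by meson
  then show "\<exists>L. ((\<lambda>z. f z + g z) has_derivative L) (at z) \<and> (\<forall>c v. L (c *s v) = c * L v)"
    by (intro exI[of _ "\<lambda>v. L v + L' v"]) (auto intro: has_derivative_add simp: distrib_left)
qed

lemma holo_n_cmult:
  assumes "holo_n \<Omega> f" shows "holo_n \<Omega> (\<lambda>z. c * f z)"
  unfolding holo_n_def
proof
  fix z assume "z \<in> \<Omega>"
  then obtain L where L: "(f has_derivative L) (at z)" "\<forall>c v. L (c *s v) = c * L v"
    using assms unfolding holo_n_def by blast
  then show "\<exists>L. ((\<lambda>z. c * f z) has_derivative L) (at z) \<and> (\<forall>c v. L (c *s v) = c * L v)"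
    by (intro exI[of _ "\<lambda>v. c * L v"]) (auto intro: has_derivative_mult_right)
qed

lemma Ap_space_add:
  "f \<in> Ap_space \<Omega> wt p \<Longrightarrow> g \<in> Ap_space \<Omega> wt p \<Longrightarrow> 0 \<le> p \<Longrightarrow> (\<lambda>z. f z + g z) \<in> Ap_space \<Omega> wt p"
  unfolding Ap_space_def by (auto intro: Lp_space_add holo_n_add)

lemma Ap_space_cmult: "f \<in> Ap_space \<Omega> wt p \<Longrightarrow> (\<lambda>z. c * f z) \<in> Ap_space \<Omega> wt p"
  unfolding Ap_space_def by (auto intro: Lp_space_cmult holo_n_cmult)

lemma Ap_space_zero: "(\<lambda>z. 0) \<in> Ap_space \<Omega> wt p"
  unfolding Ap_space_def holo_n_def
  by (auto intro!: Lp_space_zero exI[of _ "\<lambda>_. 0"])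

lemma Ap_space_sum:
  assumes "\<And>i. i \<in> I \<Longrightarrow> f i \<in> Ap_space \<Omega> wt p" "0 \<le> p"
  shows "(\<lambda>z. \<Sum>i\<in>I. f i z) \<in> Ap_space \<Omega> wt p"
  using assms by (induction I rule: infinite_finite_induct) (auto intro: Ap_space_add Ap_space_zero)

lemma Ap_space_diff:
  assumes "f \<in> Ap_space \<Omega> wt p" "g \<in> Ap_space \<Omega> wt p" "0 \<le> p"
  shows "(\<lambda>z. f z - g z) \<in> Ap_space \<Omega> wt p"
  using Ap_space_add[OF assms(1) Ap_space_cmult[OF assms(2), of "-1"] assms(3)] by simp

section \<open>Truncation by cubes of exponents\<close>

lemma supnorm_le_iff: "supnorm \<alpha> \<le> int N \<longleftrightarrow> (\<forall>j. \<bar>\<alpha> j\<bar> \<le> int N)"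
  unfolding supnorm_def by (subst Max_le_iff) auto

lemma finite_supnorm_le: "finite {\<alpha>::'n::finite \<Rightarrow> int. supnorm \<alpha> \<le> int N}"
proof (rule finite_subset)
  show "{\<alpha>::'n \<Rightarrow> int. supnorm \<alpha> \<le> int N} \<subseteq> (\<Pi>\<^sub>E j\<in>UNIV. {- int N..int N})"
    by (auto simp: supnorm_le_iff abs_le_iff) (metis minus_le_iff)
qed (auto intro: finite_PiE)

text \<open>The cubes are cofinal among the finite sets of exponents, so an unordered sum can be
  evaluated along the truncations that \<open>is_MBP\<close> and \<open>mb_kernel\<close>
  prescribe.\<close>

lemma filterlim_supnorm_le:
  "filterlim (\<lambda>N. {\<alpha> \<in> S. supnorm \<alpha> \<le> int N}) (finite_subsets_at_top S) sequentially"
  unfolding filterlim_iff eventually_finite_subsets_at_top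
proof (intro allI impI)
  fix P assume "\<exists>X. finite X \<and> X \<subseteq> S \<and> (\<forall>Y. finite Y \<and> X \<subseteq> Y \<and> Y \<subseteq> S \<longrightarrow> P Y)"
  then obtain X where "finite X \<and> X \<subseteq> S \<and> (\<forall>Y. finite Y \<and> X \<subseteq> Y \<and> Y \<subseteq> S \<longrightarrow> P Y)" ..
  then have X: "finite X" "\<And>Y. finite Y \<Longrightarrow> X \<subseteq> Y \<Longrightarrow> Y \<subseteq> S \<Longrightarrow> P Y" "X \<subseteq> S"
    by simp_all
  have "\<forall>\<^sub>F N in sequentially. P {\<alpha> \<in> S. supnorm \<alpha> \<le> int N}"
  proof (rule eventually_sequentiallyI[of "Max (insert 0 ((\<lambda>\<alpha>. nat (supnorm \<alpha>)) ` X))"])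
    fix N assume N: "Max (insert 0 ((\<lambda>\<alpha>. nat (supnorm \<alpha>)) ` X)) \<le> N"
    have "nat (supnorm \<alpha>) \<le> N" if "\<alpha> \<in> X" for \<alpha>
      by (rule order_trans[OF Max_ge N]) (use X(1) that in auto)
    then have "supnorm \<alpha> \<le> int N" if "\<alpha> \<in> X" for \<alpha>
      using that by (simp add: nat_le_iff)
    then have "X \<subseteq> {\<alpha> \<in> S. supnorm \<alpha> \<le> int N}"
      using X(3) by blast
    moreover have "finite {\<alpha> \<in> S. supnorm \<alpha> \<le> int N}"
      by (rule finite_subset[OF _ finite_supnorm_le[of N]]) blast
    ultimately show "P {\<alpha> \<in> S. supnorm \<alpha> \<le> int N}"
      by (intro X(2)) auto
  qed
  then show "\<forall>\<^sub>F N in sequentially. P {\<alpha> \<in> S. supnorm \<alpha> \<le> int N}" .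
qed

lemma finite_trunc_set: "finite (trunc_set \<Omega> wt p N)"
  unfolding trunc_set_def by (rule finite_subset[OF _ finite_supnorm_le]) auto

lemma trunc_set_mono: "m \<le> n \<Longrightarrow> trunc_set \<Omega> wt p m \<subseteq> trunc_set \<Omega> wt p n"
  unfolding trunc_set_def by auto

lemma trunc_set_subset: "trunc_set \<Omega> wt p N \<subseteq> Sp_set \<Omega> wt p"
  unfolding trunc_set_def by auto

lemma has_sum_imp_trunc_limit:
  assumes "(f has_sum s) (Sp_set \<Omega> wt p)"
  shows "(\<lambda>N. \<Sum>\<alpha>\<in>trunc_set \<Omega> wt p N. f \<alpha>) \<longlonglongrightarrow> s"
  using filterlim_compose[OF assms[unfolded has_sum_def] filterlim_supnorm_le]
  by (simp add: trunc_set_def)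

section \<open>Torus invariance and uniqueness of Laurent coefficients\<close>

lemma reinhardt_torus_act:
  assumes "reinhardt \<Omega>" "\<And>i. norm (u i) = 1" "z \<in> \<Omega>"
  shows "torus_act u z \<in> \<Omega>"
proof -
  have "exp (\<i> * of_real (Arg (u i))) = u i" for i
    using Arg_eq[of "u i"] assms(2)[of i] by (metis mult_1 norm_zero of_real_1 zero_neq_one)
  then have "torus_act u z = (\<chi> i. exp (\<i> * of_real (Arg (u i))) * z$i)"
    by (simp add: torus_act_def)
  then show ?thesis using assms by (simp add: reinhardt_def)
qed

lemma torus_act_inverse:
  assumes "\<And>i. norm (u i) = 1"
  shows "torus_act (\<lambda>i. inverse (u i)) (torus_act u z) = z"
proof -
  have "u i \<noteq> 0" for i using assms[of i] by auto
  then show ?thesis by (simp add: torus_act_def vec_eq_iff)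
qed

lemma reinhardt_torus_act_iff:
  assumes "reinhardt \<Omega>" "\<And>i. norm (u i) = 1"
  shows "torus_act u z \<in> \<Omega> \<longleftrightarrow> z \<in> \<Omega>"
  using reinhardt_torus_act[OF assms] torus_act_inverse[OF assms(2), where z=z]
    reinhardt_torus_act[OF assms(1), of "\<lambda>i. inverse (u i)" "torus_act u z"] assms(2)
  by (auto simp: norm_inverse)

lemma multi_radial_torus_act:
  assumes "reinhardt \<Omega>" "multi_radial \<Omega> wt" "\<And>i. norm (u i) = 1"
  shows "wt (torus_act u z) * indicator \<Omega> (torus_act u z) = wt z * indicator \<Omega> z"
proof (cases "z \<in> \<Omega>")
  case True
  then have "torus_act u z \<in> \<Omega>" using reinhardt_torus_act_iff assms by blast
  moreover have "wt (torus_act u z) = wt z"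
  proof -
    have "norm (torus_act u z $ j) = norm (z $ j)" for j
      by (simp add: torus_act_def norm_mult assms(3))
    then show ?thesis
      using assms(2) True calculation unfolding multi_radial_def by blast
  qed
  ultimately show ?thesis using True by simp
next
  case False
  then have "torus_act u z \<notin> \<Omega>" using reinhardt_torus_act_iff assms by blast
  then show ?thesis using False by simp
qed

text \<open>Integrate against a monomial over a small Reinhardt neighbourhood of a torus and use
  orthogonality.\<close>
lemma laurent_series_unique:
  fixes \<Omega> :: "(complex^'n::finite) set"
  assumes op: "open \<Omega>" "\<Omega> \<noteq> {}" and R: "reinhardt \<Omega>"
    and c: "laurent_series \<Omega> f c" and c': "laurent_series \<Omega> f c'"
  shows "c = c'"
proof
  fix \<beta> :: "'n \<Rightarrow> int"
  obtain a where a: "a \<in> \<Omega>" "\<And>j. a$j \<noteq> 0"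
    using open_has_nonzero_coordinates[OF op] by blast
  obtain \<epsilon> where \<epsilon>: "\<epsilon> > 0" "{z. \<forall>j. z$j \<in> cball (a$j) \<epsilon>} \<subseteq> \<Omega>"
    using closed_polydisc_subset[OF op(1) a(1)] by blast
  \<comment> \<open>Half the smallest modulus keeps the set \<open>K\<close> below off the
    coordinate hyperplanes, so that all monomials are continuous on it.\<close>
  define \<delta> where "\<delta> = min \<epsilon> (Min (range (\<lambda>j. norm (a$j))) / 2)"
  have "Min (range (\<lambda>j. norm (a$j))) > 0" using a by (subst Min_gr_iff) auto
  moreover have "Min (range (\<lambda>j. norm (a$j))) \<le> norm (a$j)" for j by (rule Min_le) auto
  ultimately have "Min (range (\<lambda>j. norm (a$j))) / 2 > 0" "Min (range (\<lambda>j. norm (a$j))) / 2 < norm (a$j)" for j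
    by (simp, smt (verit) field_sum_of_halves)
  then have \<delta>: "\<delta> > 0" "\<delta> \<le> \<epsilon>" "\<delta> < norm (a$j)" for j
    using \<epsilon> by (auto simp: \<delta>_def min_less_iff_disj)
  \<comment> \<open>The torus orbit of a closed polydisc about \<open>a\<close>: invariant under
    rotations by definition, compact, and with nonempty interior.\<close>
  define K where "K = {z::complex^'n. \<forall>j. \<bar>norm (z$j) - norm (a$j)\<bar> \<le> \<delta>}"
  have KO: "K \<subseteq> \<Omega>"
  proof
    fix z assume z: "z \<in> K"
    \<comment> \<open>Rotates each nonzero coordinate of \<open>z\<close> to the argument of the
      corresponding coordinate of \<open>a\<close>, which leaves only the difference of the moduli
      as distance.\<close>
    define v where "v j = (if z$j = 0 then 1 else (a$j / of_real (norm (a$j))) * (of_real (norm (z$j)) / z$j))" for j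
    have v: "norm (v j) = 1" for j using a by (simp add: v_def norm_mult norm_divide)
    have "torus_act v z $ j \<in> cball (a$j) \<delta>" for j
    proof -
      have "torus_act v z $ j = (a$j / of_real (norm (a$j))) * of_real (norm (z$j))"
        by (simp add: torus_act_def v_def)
      then have "a$j - torus_act v z $ j = (a$j / of_real (norm (a$j))) * of_real (norm (a$j) - norm (z$j))"
        using a by (simp add: algebra_simps)
      then have "dist (a$j) (torus_act v z $ j) = \<bar>norm (a$j) - norm (z$j)\<bar>"
        using a unfolding dist_norm by (simp add: norm_mult norm_divide del: of_real_diff)
      then show ?thesis using z by (simp add: K_def abs_minus_commute)
    qed
    then have "torus_act v z \<in> {z. \<forall>j. z$j \<in> cball (a$j) \<epsilon>}"
      using subset_cball[OF \<delta>(2)] by blast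
    then have "torus_act v z \<in> \<Omega>" using \<epsilon>(2) by blast
    then show "z \<in> \<Omega>" using reinhardt_torus_act_iff[OF R v] by simp
  qed
  have "a \<in> K" using \<delta>(1) by (simp add: K_def)
  then have Kne: "K \<noteq> {}" by auto
  have K0: "z$j \<noteq> 0" if "z \<in> K" for z j
    using that \<delta>(3)[of j] by (auto simp: K_def dest!: spec[of _ j])
  have "closed K" unfolding K_def by (intro closed_Collect_all closed_Collect_le continuous_intros)
  moreover have "bounded K"
  proof (rule boundedI)
    fix z assume z: "z \<in> K"
    then have "norm (z$j) \<le> norm (a$j) + \<delta>" for j by (auto simp: K_def abs_le_iff algebra_simps) 
    then show "norm z \<le> (\<Sum>j\<in>UNIV. norm (a$j) + \<delta>)"
      unfolding norm_vec_def by (intro order_trans[OF L2_set_le_sum] sum_mono) auto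
  qed
  ultimately have Kc: "compact K" by (simp add: compact_eq_bounded_closed)
  then have Kfin: "emeasure lebesgue K < \<infinity>" and Ks [measurable]: "K \<in> sets lebesgue"
    using emeasure_bounded_finite[OF \<open>bounded K\<close>] \<open>closed K\<close> by auto
  \<comment> \<open>The indicator of \<open>K\<close> serves as a torus-invariant weight, so that
    \<open>monom_orthogonal\<close> applies to it.\<close>
  define \<mu> where "\<mu> = density lebesgue (indicator K :: complex^'n \<Rightarrow> ennreal)"
  have fin\<mu>: "finite_measure \<mu>"
    by (rule finite_measureI) (use Kfin in \<open>simp add: \<mu>_def emeasure_density\<close>)
  have inv: "(indicator K (torus_act u z) :: ennreal) = indicator K z" if "\<And>i. norm (u i) = 1" for u and z :: "complex^'n"
    using that by (simp add: indicator_def K_def torus_act_def norm_mult)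
  have AEK: "AE z in \<mu>. z \<in> K"
    unfolding \<mu>_def by (subst AE_density) (auto simp: indicator_def)
  define d where "d \<alpha> = c \<alpha> - c' \<alpha>" for \<alpha>
  define B where "B \<alpha> = (SUP z\<in>K. norm (c \<alpha> * monom \<alpha> z)) + (SUP z\<in>K. norm (c' \<alpha> * monom \<alpha> z))" for \<alpha>
  have Bsum: "B summable_on UNIV"
    unfolding B_def using c c' Kc KO Kne by (intro summable_on_add) (auto simp: laurent_series_def)
  have monK: "continuous_on K (monom \<alpha>)" for \<alpha>
    unfolding monom_def by (intro continuous_intros) (use K0 in auto)
  have bdd: "bdd_above ((\<lambda>z. norm (k * monom \<alpha> z)) ` K)" for k \<alpha>
    by (intro bounded_imp_bdd_above compact_imp_bounded compact_continuous_image continuous_intros monK Kc)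
  have B: "norm (d \<alpha> * monom \<alpha> z) \<le> B \<alpha>" if "z \<in> K" for \<alpha> z
  proof -
    have "norm (d \<alpha> * monom \<alpha> z) \<le> norm (c \<alpha> * monom \<alpha> z) + norm (c' \<alpha> * monom \<alpha> z)"
      using norm_triangle_ineq4[of "c \<alpha> * monom \<alpha> z" "c' \<alpha> * monom \<alpha> z"] by (simp add: d_def left_diff_distrib)
    also have "\<dots> \<le> B \<alpha>"
      unfolding B_def by (intro add_mono cSUP_upper that bdd)
    finally show ?thesis .
  qed
  have B0: "B \<alpha> \<ge> 0" for \<alpha>
    using B[OF \<open>a \<in> K\<close>, of \<alpha>] norm_ge_zero order_trans by blast
  define Q where "Q N = {\<alpha>\<in>UNIV::('n \<Rightarrow> int) set. supnorm \<alpha> \<le> int N}" for N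
  have Qfin: "finite (Q N)" for N using finite_supnorm_le by (simp add: Q_def)
  have lim: "(\<lambda>N. \<Sum>\<alpha>\<in>Q N. d \<alpha> * monom \<alpha> z) \<longlonglongrightarrow> 0" if "z \<in> K" for z
  proof -
    have "((\<lambda>\<alpha>. c \<alpha> * monom \<alpha> z + - (c' \<alpha> * monom \<alpha> z)) has_sum (f z + - f z)) UNIV"
      using c c' that KO by (intro has_sum_add) (auto simp: laurent_series_def has_sum_uminus)
    then have "((\<lambda>\<alpha>. d \<alpha> * monom \<alpha> z) has_sum 0) UNIV"
      by (simp add: d_def left_diff_distrib)
    then show ?thesis
      unfolding has_sum_def Q_def using filterlim_supnorm_le by (rule filterlim_compose)
  qed
  \<comment> \<open>This is just the conjugate monomial; the factor with exponent 0 only matches the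
    form of \<open>monom_orthogonal\<close> with \<open>r = 0\<close>.\<close>
  define g where "g z = cnj (monom \<beta> z) * of_real (norm (monom \<beta> z) powr 0)" for z
  note [measurable] = borel_measurable_monom_lebesgue
  have mm [measurable]: "monom \<alpha> \<in> borel_measurable \<mu>" for \<alpha>
    unfolding \<mu>_def measurable_density_eq1 by measurable
  have gm [measurable]: "g \<in> borel_measurable \<mu>"
    unfolding g_def by measurable
  obtain G where G: "\<And>z. z \<in> K \<Longrightarrow> norm (g z) \<le> G"
  proof -
    have "bdd_above ((\<lambda>z. norm (1 * monom \<beta> z)) ` K)" by (rule bdd)
    then obtain G where "\<And>z. z \<in> K \<Longrightarrow> norm (monom \<beta> z) \<le> G" by (auto simp: bdd_above_def)
    moreover have "norm (g z) \<le> norm (monom \<beta> z)" for z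
      by (simp add: g_def norm_mult)
    ultimately show ?thesis using that by (meson order_trans)
  qed
  have int: "integrable \<mu> (\<lambda>z. monom \<alpha> z * g z)" for \<alpha>
  proof -
    have "bdd_above ((\<lambda>z. norm (1 * monom \<alpha> z)) ` K)" by (rule bdd)
    then obtain H where H: "\<And>z. z \<in> K \<Longrightarrow> norm (monom \<alpha> z) \<le> H" by (auto simp: bdd_above_def)
    show ?thesis
    proof (rule finite_measure.integrable_const_bound[OF fin\<mu>, where B="H * G"])
      show "AE z in \<mu>. norm (monom \<alpha> z * g z) \<le> H * G"
        using AEK
      proof eventually_elim
        case (elim z)
        have "norm (monom \<alpha> z) * norm (g z) \<le> H * G"
          using H[OF elim] G[OF elim] by (intro mult_mono) (auto intro: order_trans[OF norm_ge_zero])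
        then show ?case by (simp add: norm_mult)
      qed
    qed measurable
  qed
  have lim0: "(\<lambda>N. \<integral>z. (\<Sum>\<alpha>\<in>Q N. d \<alpha> * monom \<alpha> z) * g z \<partial>\<mu>) \<longlonglongrightarrow> (\<integral>z. 0 \<partial>\<mu>)"
  proof (rule integral_dominated_convergence[where w="\<lambda>_. infsum B UNIV * G"])
    show "integrable \<mu> (\<lambda>_. infsum B UNIV * G)"
      using finite_measure.integrable_const[OF fin\<mu>] by blast
    show "AE z in \<mu>. (\<lambda>N. (\<Sum>\<alpha>\<in>Q N. d \<alpha> * monom \<alpha> z) * g z) \<longlonglongrightarrow> 0"
      using AEK by eventually_elim (use tendsto_mult_left_zero[OF lim] in auto)
    fix N
    show "AE z in \<mu>. norm ((\<Sum>\<alpha>\<in>Q N. d \<alpha> * monom \<alpha> z) * g z) \<le> infsum B UNIV * G"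
      using AEK
    proof eventually_elim
      case (elim z)
      have "norm (\<Sum>\<alpha>\<in>Q N. d \<alpha> * monom \<alpha> z) \<le> (\<Sum>\<alpha>\<in>Q N. B \<alpha>)"
        by (intro sum_norm_le B elim)
      also have "\<dots> \<le> infsum B UNIV"
        by (rule finite_sum_le_infsum[OF Bsum Qfin]) (use B0 in auto)
      finally show ?case
        unfolding norm_mult using G[OF elim] B0 by (intro mult_mono infsum_nonneg) auto
    qed
  qed measurable
  have single: "(\<integral>z. (\<Sum>\<alpha>\<in>Q N. d \<alpha> * monom \<alpha> z) * g z \<partial>\<mu>) = d \<beta> * (\<integral>z. monom \<beta> z * g z \<partial>\<mu>)"
    if "N \<ge> nat (supnorm \<beta>)" for N
  proof -
    have "(\<integral>z. (\<Sum>\<alpha>\<in>Q N. d \<alpha> * monom \<alpha> z) * g z \<partial>\<mu>) = (\<Sum>\<alpha>\<in>Q N. d \<alpha> * (\<integral>z. monom \<alpha> z * g z \<partial>\<mu>))"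
      by (simp add: sum_distrib_right mult.assoc int)
    also have "\<dots> = (\<Sum>\<alpha>\<in>Q N. if \<alpha> = \<beta> then d \<alpha> * (\<integral>z. monom \<alpha> z * g z \<partial>\<mu>) else 0)"
    proof (rule sum.cong[OF refl])
      fix \<alpha>
      have "(\<integral>z. monom \<alpha> z * g z \<partial>\<mu>) = 0" if "\<alpha> \<noteq> \<beta>"
        unfolding g_def \<mu>_def by (rule monom_orthogonal) (use that inv in auto)
      then show "d \<alpha> * (\<integral>z. monom \<alpha> z * g z \<partial>\<mu>) = (if \<alpha> = \<beta> then d \<alpha> * (\<integral>z. monom \<alpha> z * g z \<partial>\<mu>) else 0)"
        by simp
    qed
    also have "\<dots> = d \<beta> * (\<integral>z. monom \<beta> z * g z \<partial>\<mu>)"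
      using that Qfin by (simp add: Q_def nat_le_iff)
    finally show ?thesis .
  qed
  have "(\<lambda>N. d \<beta> * (\<integral>z. monom \<beta> z * g z \<partial>\<mu>)) \<longlonglongrightarrow> (\<integral>z. 0 \<partial>\<mu>)"
    by (rule Lim_transform_eventually[OF lim0 eventually_sequentiallyI[of "nat (supnorm \<beta>)"]]) (rule single)
  then have prod0: "d \<beta> * (\<integral>z. monom \<beta> z * g z \<partial>\<mu>) = 0"
    by (simp add: LIMSEQ_const_iff)
  \<comment> \<open>The integrand is the squared modulus of the monomial. It has no zero on
    \<open>K\<close>, and \<open>K\<close> contains a nonempty open set.\<close>
  have "(\<integral>z. monom \<beta> z * g z \<partial>\<mu>) \<noteq> 0"
  proof
    assume 0: "(\<integral>z. monom \<beta> z * g z \<partial>\<mu>) = 0"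
    have eq: "monom \<beta> z * g z = of_real ((norm (monom \<beta> z))\<^sup>2)" for z
      by (simp add: g_def complex_norm_square[symmetric] mult.assoc[symmetric])
    have i2: "integrable \<mu> (\<lambda>z. (norm (monom \<beta> z))\<^sup>2)"
      using integrable_Re[OF int[of \<beta>]] unfolding eq by simp
    have "(\<integral>z. (norm (monom \<beta> z))\<^sup>2 \<partial>\<mu>) = 0"
      using 0 unfolding eq by (simp only: integral_complex_of_real of_real_eq_0_iff)
    then have "AE z in \<mu>. (norm (monom \<beta> z))\<^sup>2 = 0"
      using integral_nonneg_eq_0_iff_AE[OF i2] by simp
    with AEK have "AE z in \<mu>. False"
      by eventually_elim (use K0 in \<open>auto simp: monom_def\<close>)
    then have "AE z in lebesgue. z \<notin> K"
      unfolding \<mu>_def by (subst (asm) AE_density) (auto simp: indicator_def)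
    then have "negligible K"
      by (simp add: negligible_iff_null_sets AE_iff_null_sets)
    moreover define U where "U = (\<Inter>j. {z::complex^'n. \<bar>norm (z$j) - norm (a$j)\<bar> < \<delta>})"
    have "open U" unfolding U_def by (intro open_INT finite ballI open_Collect_less continuous_intros)
    moreover have "a \<in> U" using \<delta>(1) by (simp add: U_def)
    moreover have "U \<subseteq> K" by (auto simp: U_def K_def less_imp_le)
    ultimately show False using open_not_negligible negligible_subset by blast
  qed
  with prod0 show "c \<beta> = c' \<beta>" by (simp add: d_def)
qed

section \<open>Coefficient functionals\<close>

lemma mult_cnj_norm_powr:
  fixes e :: complex
  shows "e * (cnj e * of_real (norm e powr (p - 2))) = of_real (norm e powr p)"
proof (cases "e = 0")
  case False
  have "e * (cnj e * of_real (norm e powr (p - 2))) = of_real ((norm e)\<^sup>2 * norm e powr (p - 2))"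
    by (simp add: complex_norm_square[symmetric] mult.assoc[symmetric])
  also have "(norm e)\<^sup>2 * norm e powr (p - 2) = norm e powr p"
    using False by (simp add: powr_diff)
  finally show ?thesis .
qed simp

locale weighted_reinhardt =
  fixes \<Omega> :: "(complex^'n::finite) set" and wt :: "complex^'n \<Rightarrow> ennreal" and p :: real
  assumes open_\<Omega>: "open \<Omega>" and nonempty_\<Omega>: "\<Omega> \<noteq> {}" and reinhardt_\<Omega>: "reinhardt \<Omega>"
    and p_gt_1: "1 < p"
    and wt_measurable: "(\<lambda>z. wt z * indicator \<Omega> z) \<in> borel_measurable lebesgue"
    and admissible_wt: "admissible \<Omega> wt p" and multi_radial_wt: "multi_radial \<Omega> wt"
begin

abbreviation "M \<equiv> wmeasure \<Omega> wt"
abbreviation "Lp \<equiv> Lp_space \<Omega> wt p"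
abbreviation "Ap \<equiv> Ap_space \<Omega> wt p"
abbreviation "Sp \<equiv> Sp_set \<Omega> wt p"
abbreviation "pnorm \<equiv> Lpnorm \<Omega> wt p"

text \<open>For an exponent in \<open>Sp\<close> this is, up to a positive factor, the element of
  L^q that norms the monomial in L^p.\<close>

definition dual_monom :: "('n \<Rightarrow> int) \<Rightarrow> complex^'n \<Rightarrow> complex" where
  "dual_monom \<alpha> w = cnj (monom \<alpha> w) * of_real (norm (monom \<alpha> w) powr (p - 2))"

text \<open>The candidate for the norm-preserving extension of the Laurent coefficient functional.\<close>
definition coeff :: "('n \<Rightarrow> int) \<Rightarrow> (complex^'n \<Rightarrow> complex) \<Rightarrow> complex" where
  "coeff \<alpha> f = (\<integral>w. f w * dual_monom \<alpha> w \<partial>M) / of_real (pnorm (monom \<alpha>) powr p)"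

lemma p_pos: "0 \<le> p" "0 < p" using p_gt_1 by auto

lemma monom_measurable [measurable]: "monom \<alpha> \<in> borel_measurable M"
  unfolding wmeasure_measurable_iff by (rule borel_measurable_monom_lebesgue)

lemma dual_monom_measurable [measurable]: "dual_monom \<alpha> \<in> borel_measurable M"
  unfolding dual_monom_def by measurable

lemma Lp_measurable: "f \<in> Lp \<Longrightarrow> f \<in> borel_measurable M"
  and Lp_integrable: "f \<in> Lp \<Longrightarrow> integrable M (\<lambda>z. norm (f z) powr p)"
  by (simp_all add: mem_Lp_space_iff)

lemma Ap_Lp: "f \<in> Ap \<Longrightarrow> f \<in> Lp"
  by (simp add: Ap_space_def)

lemma Sp_Ap: "\<alpha> \<in> Sp \<Longrightarrow> monom \<alpha> \<in> Ap"
  by (simp add: Sp_set_def)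

lemma Sp_Lp: "\<alpha> \<in> Sp \<Longrightarrow> monom \<alpha> \<in> Lp"
  by (simp add: Sp_Ap Ap_Lp)

lemma pnorm_nonneg: "0 \<le> pnorm f"
  by (simp add: Lpnorm_def)

lemma pnorm_powr: "f \<in> Lp \<Longrightarrow> pnorm f powr p = (\<integral>z. norm (f z) powr p \<partial>M)"
  using p_gt_1 by (simp add: Lpnorm_eq_integral powr_powr)

lemma AE_in_\<Omega>: "AE z in M. z \<in> \<Omega>"
  unfolding wmeasure_def using wt_measurable by (subst AE_density) (auto simp: indicator_def)

lemma Ap_pointwise_bound:
  assumes "compact K" "K \<subseteq> \<Omega>"
  shows "\<exists>C\<ge>0. \<forall>f\<in>Ap. \<forall>z\<in>K. norm (f z) \<le> C * pnorm f"
proof -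
  obtain C where "\<forall>f\<in>Ap. \<forall>z\<in>K. norm (f z) \<le> C * pnorm f"
    using admissible_wt assms unfolding admissible_def by blast
  moreover have "C * pnorm f \<le> \<bar>C\<bar> * pnorm f" for f
    by (intro mult_right_mono pnorm_nonneg) auto
  ultimately show ?thesis by (intro exI[of _ "\<bar>C\<bar>"]) (auto intro: order_trans)
qed

text \<open>If the norm were 0, admissibility would force the monomial to vanish at a point with
  nonzero coordinates.\<close>

lemma pnorm_monom_pos:
  assumes "\<alpha> \<in> Sp" shows "0 < pnorm (monom \<alpha>)"
proof -
  obtain a where a: "a \<in> \<Omega>" "\<forall>j. a$j \<noteq> 0"
    using open_has_nonzero_coordinates[OF open_\<Omega> nonempty_\<Omega>] by blast
  have "\<exists>C\<ge>0. \<forall>f\<in>Ap. \<forall>z\<in>{a}. norm (f z) \<le> C * pnorm f"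
    by (rule Ap_pointwise_bound) (use a in auto)
  then obtain C where "norm (monom \<alpha> a) \<le> C * pnorm (monom \<alpha>)"
    using Sp_Ap[OF assms] by blast
  moreover have "norm (monom \<alpha> a) > 0" using a by (simp add: monom_def)
  ultimately have "pnorm (monom \<alpha>) \<noteq> 0" by auto
  then show ?thesis using pnorm_nonneg[of "monom \<alpha>"] by simp
qed

lemma integral_monom_pos: "\<alpha> \<in> Sp \<Longrightarrow> 0 < (\<integral>z. norm (monom \<alpha> z) powr p \<partial>M)"
  using pnorm_monom_pos[of \<alpha>] pnorm_powr[OF Sp_Lp, of \<alpha>] by (metis powr_gt_zero less_irrefl)

lemma integrable_pairing:
  "f \<in> Lp \<Longrightarrow> \<alpha> \<in> Sp \<Longrightarrow> integrable M (\<lambda>w. f w * dual_monom \<alpha> w)"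
  unfolding dual_monom_def
  by (intro integrable_dual_pairing Lp_measurable Lp_integrable Sp_Lp p_gt_1)

text \<open>Hoelder's inequality leaves the integral \<open>?B\<close> of |e|^p with exponent 1 -
  1/p; dividing by \<open>?B\<close> leaves the exponent -1/p, which is the reciprocal norm.\<close>

lemma coeff_bound:
  assumes f: "f \<in> Lp" and \<alpha>: "\<alpha> \<in> Sp"
  shows "norm (coeff \<alpha> f) \<le> pnorm f / pnorm (monom \<alpha>)"
proof -
  let ?B = "\<integral>z. norm (monom \<alpha> z) powr p \<partial>M"
  have B: "0 < ?B" by (rule integral_monom_pos[OF \<alpha>])
  have "norm (\<integral>w. f w * dual_monom \<alpha> w \<partial>M) \<le> pnorm f * ?B powr (1 - 1/p)"
    unfolding dual_monom_def Lpnorm_eq_integral[OF f]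
    by (intro Holder_dual_pairing Lp_measurable Lp_integrable f Sp_Lp \<alpha> p_gt_1 B)
  then have "norm (coeff \<alpha> f) \<le> pnorm f * ?B powr (1 - 1/p) / ?B"
    using B unfolding coeff_def pnorm_powr[OF Sp_Lp[OF \<alpha>]]
    by (simp add: norm_divide divide_right_mono)
  also have "\<dots> = pnorm f / pnorm (monom \<alpha>)"
    using B unfolding Lpnorm_eq_integral[OF Sp_Lp[OF \<alpha>]] by (simp add: powr_diff)
  finally show ?thesis .
qed

lemma coeff_add:
  "f \<in> Lp \<Longrightarrow> g \<in> Lp \<Longrightarrow> \<alpha> \<in> Sp \<Longrightarrow> coeff \<alpha> (\<lambda>z. f z + g z) = coeff \<alpha> f + coeff \<alpha> g"
  unfolding coeff_def by (simp add: distrib_right integrable_pairing add_divide_distrib)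

lemma coeff_cmult: "coeff \<alpha> (\<lambda>z. c * f z) = c * coeff \<alpha> f"
  unfolding coeff_def by (simp add: mult.assoc)

lemma coeff_sum:
  assumes "\<And>i. i \<in> I \<Longrightarrow> f i \<in> Lp" "\<alpha> \<in> Sp"
  shows "coeff \<alpha> (\<lambda>z. \<Sum>i\<in>I. f i z) = (\<Sum>i\<in>I. coeff \<alpha> (f i))"
  using assms
proof (induction I rule: infinite_finite_induct)
  case (insert i I)
  then show ?case
    using coeff_add[of "f i" "\<lambda>z. \<Sum>i\<in>I. f i z" \<alpha>] Lp_space_sum[of I f \<Omega> wt p] p_pos by simp
qed (simp_all add: coeff_def)

text \<open>Members of \<open>Lp\<close> are functions on the whole space, while \<open>P\<close>
  reproduces only on \<Omega>; the weighted measure does not see the complement.\<close>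

lemma coeff_cong:
  assumes "f \<in> Lp" "g \<in> Lp" "\<And>z. z \<in> \<Omega> \<Longrightarrow> f z = g z"
  shows "coeff \<alpha> f = coeff \<alpha> g"
proof -
  note [measurable] = Lp_measurable[OF assms(1)] Lp_measurable[OF assms(2)]
  have "(\<integral>w. f w * dual_monom \<alpha> w \<partial>M) = (\<integral>w. g w * dual_monom \<alpha> w \<partial>M)"
    by (rule integral_cong_AE) (use AE_in_\<Omega> assms(3) in \<open>auto elim: eventually_mono\<close>)
  then show ?thesis by (simp add: coeff_def)
qed

lemma coeff_monom:
  assumes "\<alpha> \<in> Sp"
  shows "coeff \<alpha> (monom \<beta>) = (if \<alpha> = \<beta> then 1 else 0)"
proof (cases "\<alpha> = \<beta>")
  case True
  have "(\<integral>w. monom \<alpha> w * dual_monom \<alpha> w \<partial>M) = of_real (\<integral>z. norm (monom \<alpha> z) powr p \<partial>M)"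
    unfolding dual_monom_def mult_cnj_norm_powr by (rule integral_complex_of_real)
  then show ?thesis
    using True integral_monom_pos[OF assms] unfolding coeff_def pnorm_powr[OF Sp_Lp[OF assms]] by simp
next
  case False
  have "(\<integral>w. monom \<beta> w * dual_monom \<alpha> w \<partial>M) = 0"
    unfolding dual_monom_def wmeasure_def
    by (rule monom_orthogonal[OF wt_measurable _ False])
      (rule multi_radial_torus_act[OF reinhardt_\<Omega> multi_radial_wt])
  then show ?thesis using False by (simp add: coeff_def)
qed

lemma coeff_laurent_polynomial:
  assumes "finite I" "I \<subseteq> Sp" "\<alpha> \<in> Sp"
  shows "coeff \<alpha> (\<lambda>z. \<Sum>\<beta>\<in>I. c \<beta> * monom \<beta> z) = (if \<alpha> \<in> I then c \<alpha> else 0)"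
proof -
  have "coeff \<alpha> (\<lambda>z. \<Sum>\<beta>\<in>I. c \<beta> * monom \<beta> z) = (\<Sum>\<beta>\<in>I. coeff \<alpha> (\<lambda>z. c \<beta> * monom \<beta> z))"
    by (rule coeff_sum) (use assms Sp_Lp in \<open>auto intro!: Lp_space_cmult\<close>)
  also have "\<dots> = (\<Sum>\<beta>\<in>I. if \<alpha> = \<beta> then c \<beta> else 0)"
    by (rule sum.cong) (auto simp: coeff_cmult coeff_monom assms(3))
  finally show ?thesis using assms(1) by simp
qed

text \<open>A negative exponent makes the monomial unbounded as the j-th coordinate tends to 0 with
  the others fixed and nonzero, against admissibility on a compact polydisc. The value at
  \<open>a\<close> itself gives no contradiction, since \<open>powi\<close> makes it 0.\<close>

lemma exponent_nonneg_at_zero: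
  assumes \<alpha>: "\<alpha> \<in> Sp" and a: "a \<in> \<Omega>" and "a$j = 0"
  shows "0 \<le> \<alpha> j"
proof (rule ccontr)
  assume neg: "\<not> 0 \<le> \<alpha> j"
  obtain \<delta> where \<delta>: "\<delta> > 0" "{z. \<forall>j. z$j \<in> cball (a$j) \<delta>} \<subseteq> \<Omega>"
    using closed_polydisc_subset[OF open_\<Omega> a] by blast
  obtain C where C: "\<And>z. z \<in> {z. \<forall>j. z$j \<in> cball (a$j) \<delta>} \<Longrightarrow> norm (monom \<alpha> z) \<le> C * pnorm (monom \<alpha>)"
    using Ap_pointwise_bound[OF compact_polydisc \<delta>(2)] Sp_Ap[OF \<alpha>] by blast
  define B where "B = C * pnorm (monom \<alpha>)"
  have "\<forall>i. \<exists>t. t \<in> cball (a$i) \<delta> \<and> t \<noteq> 0"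
    using nonzero_in_cball[OF \<delta>(1)] by blast
  then obtain t where t: "\<And>i. t i \<in> cball (a$i) \<delta>" "\<And>i. t i \<noteq> 0"
    by metis
  define Q where "Q = (\<Prod>i\<in>UNIV - {j}. norm (t i powi \<alpha> i))"
  have Q: "Q > 0" unfolding Q_def using t(2) by (intro prod_pos) auto
  have key: "Q \<le> B * \<epsilon>" if \<epsilon>: "0 < \<epsilon>" "\<epsilon> \<le> \<delta>" "\<epsilon> \<le> 1" for \<epsilon> :: real
  proof -
    define w where "w = (\<chi> i. if i = j then of_real \<epsilon> else t i)"
    have "w \<in> {z. \<forall>j. z$j \<in> cball (a$j) \<delta>}"
      using t(1) \<epsilon> \<open>a$j = 0\<close> by (auto simp: w_def)
    then have "norm (monom \<alpha> w) \<le> B" using C by (simp add: B_def)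
    moreover have "norm (monom \<alpha> w) = norm (complex_of_real \<epsilon> powi \<alpha> j) * Q"
      unfolding monom_def prod_norm[symmetric] Q_def
      by (subst prod.remove[of _ j]) (auto simp: w_def intro!: prod.cong)
    moreover have "1 / \<epsilon> \<le> norm (complex_of_real \<epsilon> powi \<alpha> j)"
    proof -
      have "\<epsilon> ^ nat (- \<alpha> j) \<le> \<epsilon> ^ 1" using neg \<epsilon> by (intro power_decreasing) auto
      then have "1 / \<epsilon> \<le> 1 / \<epsilon> ^ nat (- \<alpha> j)"
        using \<epsilon> by (intro divide_left_mono) auto
      then show ?thesis
        using neg \<epsilon> by (simp add: power_int_def norm_inverse norm_power norm_divide inverse_eq_divide power_one_over)
    qed
    then have "(1 / \<epsilon>) * Q \<le> norm (complex_of_real \<epsilon> powi \<alpha> j) * Q"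
      using Q by (intro mult_right_mono) auto
    ultimately have "(1 / \<epsilon>) * Q \<le> B" by simp
    then show ?thesis using \<epsilon> by (simp add: field_simps)
  qed
  \<comment> \<open>The last bound makes B \<epsilon> at most Q/2, which contradicts
    \<open>key\<close>.\<close>
  define \<epsilon> where "\<epsilon> = min (min \<delta> 1) (Q / (2 * (\<bar>B\<bar> + 1)))"
  have \<epsilon>: "0 < \<epsilon>" "\<epsilon> \<le> \<delta>" "\<epsilon> \<le> 1" "\<epsilon> \<le> Q / (2 * (\<bar>B\<bar> + 1))"
    using \<delta> Q by (auto simp: \<epsilon>_def)
  have "Q \<le> B * \<epsilon>" by (rule key) (use \<epsilon> in auto)
  also have "\<dots> \<le> (\<bar>B\<bar> + 1) * \<epsilon>" using \<epsilon> by (intro mult_right_mono) auto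
  also have "\<dots> \<le> (\<bar>B\<bar> + 1) * (Q / (2 * (\<bar>B\<bar> + 1)))" using \<epsilon> by (intro mult_left_mono) auto
  also have "\<dots> = Q / 2" by (simp add: field_simps)
  finally show False using Q by simp
qed

text \<open>The product of the one-variable gains. The points obtained in the single coordinates
  form one point of the polydisc, depending on \<alpha>, and admissibility bounds the monomial there
  by a constant independent of \<alpha>; \<open>U\<close> and the ratios do not depend on \<alpha>
  either.\<close>

lemma monom_local_bound:
  assumes a: "a \<in> \<Omega>"
  shows "\<exists>U h. open U \<and> a \<in> U \<and> h summable_on UNIV \<and> (\<forall>\<alpha>. 0 \<le> h \<alpha>) \<and>
     (\<forall>\<alpha>\<in>Sp. \<forall>z\<in>U. norm (monom \<alpha> z) \<le> h \<alpha> * pnorm (monom \<alpha>))"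
proof -
  obtain \<delta> where \<delta>: "\<delta> > 0" "{z. \<forall>j. z$j \<in> cball (a$j) \<delta>} \<subseteq> \<Omega>"
    using closed_polydisc_subset[OF open_\<Omega> a] by blast
  obtain C where C: "0 \<le> C" "\<And>f z. f \<in> Ap \<Longrightarrow> z \<in> {z. \<forall>j. z$j \<in> cball (a$j) \<delta>} \<Longrightarrow> norm (f z) \<le> C * pnorm f"
    using Ap_pointwise_bound[OF compact_polydisc \<delta>(2)] by blast
  have "\<forall>j. \<exists>\<eta> \<rho>. 0 < \<eta> \<and> 0 \<le> \<rho> \<and> \<rho> < 1 \<and> (\<forall>k. a$j \<noteq> 0 \<or> 0 \<le> k \<longrightarrow>
     (\<exists>t\<in>cball (a$j) \<delta>. \<forall>z\<in>cball (a$j) \<eta>. norm (z powi k) \<le> \<rho> ^ nat \<bar>k\<bar> * norm (t powi k)))"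
    using powi_geometric_bound[OF \<delta>(1)] by blast
  from choice[OF this] obtain \<eta> where "\<forall>j. \<exists>\<rho>. 0 < \<eta> j \<and> 0 \<le> \<rho> \<and> \<rho> < 1 \<and> (\<forall>k. a$j \<noteq> 0 \<or> 0 \<le> k \<longrightarrow>
     (\<exists>t\<in>cball (a$j) \<delta>. \<forall>z\<in>cball (a$j) (\<eta> j). norm (z powi k) \<le> \<rho> ^ nat \<bar>k\<bar> * norm (t powi k)))" ..
  from choice[OF this] obtain \<rho> where "\<forall>j. 0 < \<eta> j \<and> 0 \<le> \<rho> j \<and> \<rho> j < 1 \<and> (\<forall>k. a$j \<noteq> 0 \<or> 0 \<le> k \<longrightarrow>
     (\<exists>t\<in>cball (a$j) \<delta>. \<forall>z\<in>cball (a$j) (\<eta> j). norm (z powi k) \<le> \<rho> j ^ nat \<bar>k\<bar> * norm (t powi k)))" ..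
  then have \<eta>: "0 < \<eta> j" and \<rho>: "0 \<le> \<rho> j" "\<rho> j < 1"
    and pw: "a$j \<noteq> 0 \<or> 0 \<le> k \<Longrightarrow>
     \<exists>t. t \<in> cball (a$j) \<delta> \<and> (\<forall>z\<in>cball (a$j) (\<eta> j). norm (z powi k) \<le> \<rho> j ^ nat \<bar>k\<bar> * norm (t powi k))" for j k
    unfolding Bex_def by blast+
  define U where "U = (\<Inter>j. {z::complex^'n. dist (a$j) (z$j) < \<eta> j})"
  define h where "h \<alpha> = C * (\<Prod>j\<in>UNIV. \<rho> j ^ nat \<bar>\<alpha> j\<bar>)" for \<alpha> :: "'n \<Rightarrow> int"
  have "open U" unfolding U_def by (intro open_INT finite ballI open_Collect_less continuous_intros)
  moreover have "a \<in> U" using \<eta> by (simp add: U_def)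
  moreover have "h summable_on UNIV"
    unfolding h_def by (intro summable_on_cmult_right summable_on_prod_geometric \<rho>)
  moreover have "0 \<le> h \<alpha>" for \<alpha>
    unfolding h_def using C \<rho> by (intro mult_nonneg_nonneg prod_nonneg) auto
  moreover have "norm (monom \<alpha> z) \<le> h \<alpha> * pnorm (monom \<alpha>)" if \<alpha>: "\<alpha> \<in> Sp" and z: "z \<in> U" for \<alpha> z
  proof -
    have "a$j \<noteq> 0 \<or> 0 \<le> \<alpha> j" for j using exponent_nonneg_at_zero[OF \<alpha> a] by blast
    then have "\<forall>j. \<exists>t. t \<in> cball (a$j) \<delta> \<and> (\<forall>z\<in>cball (a$j) (\<eta> j). norm (z powi \<alpha> j) \<le> \<rho> j ^ nat \<bar>\<alpha> j\<bar> * norm (t powi \<alpha> j))"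
      by (intro allI pw)
    from choice[OF this] obtain t where t: "\<And>j. t j \<in> cball (a$j) \<delta>"
       "\<And>j z. z \<in> cball (a$j) (\<eta> j) \<Longrightarrow> norm (z powi \<alpha> j) \<le> \<rho> j ^ nat \<bar>\<alpha> j\<bar> * norm (t j powi \<alpha> j)"
      by blast
    have "norm (monom \<alpha> z) \<le> (\<Prod>j\<in>UNIV. \<rho> j ^ nat \<bar>\<alpha> j\<bar> * norm (t j powi \<alpha> j))"
      unfolding monom_def prod_norm[symmetric]
      using z by (intro prod_mono conjI t(2)) (auto simp: U_def less_imp_le)
    also have "\<dots> = (\<Prod>j\<in>UNIV. \<rho> j ^ nat \<bar>\<alpha> j\<bar>) * norm (monom \<alpha> (\<chi> j. t j))"
      by (simp add: monom_def prod_norm[symmetric] prod.distrib)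
    also have "\<dots> \<le> (\<Prod>j\<in>UNIV. \<rho> j ^ nat \<bar>\<alpha> j\<bar>) * (C * pnorm (monom \<alpha>))"
      using t(1) \<rho> by (intro mult_left_mono C(2) Sp_Ap \<alpha> prod_nonneg) auto
    finally show ?thesis by (simp add: h_def mult_ac)
  qed
  ultimately show ?thesis by blast
qed

text \<open>Finite subcover; the sum of the finitely many local majorants dominates each of
  them.\<close>

lemma monom_compact_bound:
  assumes K: "compact K" "K \<subseteq> \<Omega>"
  shows "\<exists>h. h summable_on UNIV \<and> (\<forall>\<alpha>. 0 \<le> h \<alpha>) \<and>
     (\<forall>\<alpha>\<in>Sp. \<forall>z\<in>K. norm (monom \<alpha> z) \<le> h \<alpha> * pnorm (monom \<alpha>))"
proof -
  have "\<forall>a\<in>K. \<exists>U h. open U \<and> a \<in> U \<and> h summable_on UNIV \<and> (\<forall>\<alpha>. 0 \<le> h \<alpha>) \<and>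
     (\<forall>\<alpha>\<in>Sp. \<forall>z\<in>U. norm (monom \<alpha> z) \<le> h \<alpha> * pnorm (monom \<alpha>))"
    using monom_local_bound K by blast
  from bchoice[OF this] obtain U where "\<forall>a\<in>K. \<exists>h. open (U a) \<and> a \<in> U a \<and> h summable_on UNIV \<and> (\<forall>\<alpha>. 0 \<le> h \<alpha>) \<and>
     (\<forall>\<alpha>\<in>Sp. \<forall>z\<in>U a. norm (monom \<alpha> z) \<le> h \<alpha> * pnorm (monom \<alpha>))" ..
  from bchoice[OF this] obtain h where "\<forall>a\<in>K. open (U a) \<and> a \<in> U a \<and> h a summable_on UNIV \<and> (\<forall>\<alpha>. 0 \<le> h a \<alpha>) \<and>
     (\<forall>\<alpha>\<in>Sp. \<forall>z\<in>U a. norm (monom \<alpha> z) \<le> h a \<alpha> * pnorm (monom \<alpha>))" ..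
  then have U: "\<And>a. a \<in> K \<Longrightarrow> open (U a)" "\<And>a. a \<in> K \<Longrightarrow> a \<in> U a"
     "\<And>a. a \<in> K \<Longrightarrow> h a summable_on UNIV" "\<And>a \<alpha>. a \<in> K \<Longrightarrow> 0 \<le> h a \<alpha>"
     "\<And>a \<alpha> z. a \<in> K \<Longrightarrow> \<alpha> \<in> Sp \<Longrightarrow> z \<in> U a \<Longrightarrow> norm (monom \<alpha> z) \<le> h a \<alpha> * pnorm (monom \<alpha>)"
    by simp_all
  have "K \<subseteq> (\<Union>a\<in>K. U a)" using U(2) by blast
  then obtain A where A: "A \<subseteq> K" "finite A" "K \<subseteq> (\<Union>a\<in>A. U a)"
    using compactE_image[OF K(1), of K U] U(1) by blast
  show ?thesis
  proof (intro exI[of _ "\<lambda>\<alpha>. \<Sum>a\<in>A. h a \<alpha>"] conjI allI ballI)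
    show "(\<lambda>\<alpha>. \<Sum>a\<in>A. h a \<alpha>) summable_on UNIV"
      using A(2,1)
    proof (induction A rule: finite_induct)
      case (insert a A)
      then show ?case using U(3)[of a] by (auto intro!: summable_on_add)
    qed simp
    show "0 \<le> (\<Sum>a\<in>A. h a \<alpha>)" for \<alpha>
      using A U(4) by (intro sum_nonneg) auto
    fix \<alpha> z assume \<alpha>: "\<alpha> \<in> Sp" and "z \<in> K"
    then obtain a where a: "a \<in> A" "z \<in> U a" using A by blast
    have "norm (monom \<alpha> z) \<le> h a \<alpha> * pnorm (monom \<alpha>)"
      using U(5) a A \<alpha> by blast
    also have "\<dots> \<le> (\<Sum>a\<in>A. h a \<alpha>) * pnorm (monom \<alpha>)"
      by (intro mult_right_mono pnorm_nonneg member_le_sum) (use a A U(4) in auto)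
    finally show "norm (monom \<alpha> z) \<le> (\<Sum>a\<in>A. h a \<alpha>) * pnorm (monom \<alpha>)" .
  qed
qed

end

section \<open>The monomial basis projection\<close>

locale monomial_basis_projection = weighted_reinhardt \<Omega> wt p
  for \<Omega> :: "(complex^'n::finite) set" and wt and p +
  fixes P :: "(complex^'n \<Rightarrow> complex) \<Rightarrow> (complex^'n \<Rightarrow> complex)"
  assumes MBP: "is_MBP \<Omega> wt p P"
begin

abbreviation "trunc N \<equiv> trunc_set \<Omega> wt p N"

lemma P_Ap: "f \<in> Lp \<Longrightarrow> P f \<in> Ap"
  using MBP by (simp add: is_MBP_def)

lemma P_reproduces: "g \<in> Ap \<Longrightarrow> z \<in> \<Omega> \<Longrightarrow> P g z = g z"
  using MBP by (simp add: is_MBP_def)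

lemma P_limit:
  "f \<in> Lp \<Longrightarrow> (\<lambda>N. pnorm (\<lambda>z. P f z - (\<Sum>\<alpha>\<in>trunc N. ext_coeff \<Omega> wt p \<alpha> f * monom \<alpha> z))) \<longlonglongrightarrow> 0"
  using MBP by (simp add: is_MBP_def)

lemma P_remainder_Ap:
  assumes "f \<in> Lp"
  shows "(\<lambda>z. P f z - (\<Sum>\<alpha>\<in>trunc N. c \<alpha> * monom \<alpha> z)) \<in> Ap"
  using trunc_set_subset Sp_Ap assms p_pos(1)
  by (intro Ap_space_diff P_Ap Ap_space_sum Ap_space_cmult) blast+

text \<open>The remainders lie in \<open>Ap\<close>, so admissibility at the single point
  \<open>z\<close> turns norm convergence into convergence of values.\<close>

lemma P_pointwise_limit:
  assumes f: "f \<in> Lp" and z: "z \<in> \<Omega>"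
  shows "(\<lambda>N. \<Sum>\<alpha>\<in>trunc N. ext_coeff \<Omega> wt p \<alpha> f * monom \<alpha> z) \<longlonglongrightarrow> P f z"
proof -
  have "\<exists>C\<ge>0. \<forall>f\<in>Ap. \<forall>z\<in>{z}. norm (f z) \<le> C * pnorm f"
    by (rule Ap_pointwise_bound) (use z in auto)
  then obtain C where C: "\<And>g. g \<in> Ap \<Longrightarrow> norm (g z) \<le> C * pnorm g" by blast
  have "(\<lambda>N. P f z - (\<Sum>\<alpha>\<in>trunc N. ext_coeff \<Omega> wt p \<alpha> f * monom \<alpha> z)) \<longlonglongrightarrow> 0"
  proof (rule Lim_null_comparison)
    show "\<forall>\<^sub>F N in sequentially. norm (P f z - (\<Sum>\<alpha>\<in>trunc N. ext_coeff \<Omega> wt p \<alpha> f * monom \<alpha> z))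
      \<le> C * pnorm (\<lambda>z. P f z - (\<Sum>\<alpha>\<in>trunc N. ext_coeff \<Omega> wt p \<alpha> f * monom \<alpha> z))"
      using C[OF P_remainder_Ap[OF f]] by simp
    show "(\<lambda>N. C * pnorm (\<lambda>z. P f z - (\<Sum>\<alpha>\<in>trunc N. ext_coeff \<Omega> wt p \<alpha> f * monom \<alpha> z))) \<longlonglongrightarrow> 0"
      by (rule tendsto_mult_right_zero[OF P_limit[OF f]])
  qed
  then have "(\<lambda>N. P f z - (P f z - (\<Sum>\<alpha>\<in>trunc N. ext_coeff \<Omega> wt p \<alpha> f * monom \<alpha> z))) \<longlonglongrightarrow> P f z - 0"
    by (intro tendsto_diff tendsto_const)
  then show ?thesis by simp
qed

text \<open>Nothing about \<open>ext_coeff\<close> is used except that it supplies the coefficients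
  of the limit. \<open>coeff \<alpha>\<close> is continuous in the norm, and on a truncation whose
  cube contains \<alpha> it returns exactly the coefficient with index \<alpha>.\<close>

lemma ext_coeff_eq_coeff_P:
  assumes f: "f \<in> Lp" and \<alpha>: "\<alpha> \<in> Sp"
  shows "ext_coeff \<Omega> wt p \<alpha> f = coeff \<alpha> (P f)"
proof -
  let ?S = "\<lambda>N z. \<Sum>\<beta>\<in>trunc N. ext_coeff \<Omega> wt p \<beta> f * monom \<beta> z"
  have SLp: "?S N \<in> Lp" for N
    using trunc_set_subset Sp_Lp p_pos(1) by (intro Lp_space_sum Lp_space_cmult) blast+
  have eq: "coeff \<alpha> (\<lambda>z. P f z - ?S N z) = coeff \<alpha> (P f) - ext_coeff \<Omega> wt p \<alpha> f"
    if "nat (supnorm \<alpha>) \<le> N" for N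
  proof -
    have "\<alpha> \<in> trunc N" using that \<alpha> by (simp add: trunc_set_def nat_le_iff)
    then have "coeff \<alpha> (?S N) = ext_coeff \<Omega> wt p \<alpha> f"
      using coeff_laurent_polynomial[OF finite_trunc_set[where N=N] trunc_set_subset \<alpha>] by simp
    moreover have "coeff \<alpha> (\<lambda>z. P f z + (-1) * ?S N z) = coeff \<alpha> (P f) + coeff \<alpha> (\<lambda>z. (-1) * ?S N z)"
      by (rule coeff_add[OF Ap_Lp[OF P_Ap[OF f]] Lp_space_cmult[OF SLp] \<alpha>])
    moreover have "coeff \<alpha> (\<lambda>z. (-1) * ?S N z) = (-1) * coeff \<alpha> (?S N)"
      by (rule coeff_cmult)
    ultimately show ?thesis by simp
  qed
  have "(\<lambda>N. coeff \<alpha> (\<lambda>z. P f z - ?S N z)) \<longlonglongrightarrow> 0"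
  proof (rule Lim_null_comparison)
    show "\<forall>\<^sub>F N in sequentially. norm (coeff \<alpha> (\<lambda>z. P f z - ?S N z)) \<le> pnorm (\<lambda>z. P f z - ?S N z) / pnorm (monom \<alpha>)"
      using coeff_bound[OF Ap_Lp[OF P_remainder_Ap[OF f]] \<alpha>] by simp
    show "(\<lambda>N. pnorm (\<lambda>z. P f z - ?S N z) / pnorm (monom \<alpha>)) \<longlonglongrightarrow> 0"
      by (rule tendsto_divide_zero[OF P_limit[OF f]])
  qed
  then have "(\<lambda>N. coeff \<alpha> (P f) - ext_coeff \<Omega> wt p \<alpha> f) \<longlonglongrightarrow> 0"
    by (rule Lim_transform_eventually[OF _ eventually_sequentiallyI[of "nat (supnorm \<alpha>)"]]) (rule eq)
  then show ?thesis by (simp add: LIMSEQ_const_iff)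
qed

lemma ext_coeff_Ap:
  assumes g: "g \<in> Ap" and \<alpha>: "\<alpha> \<in> Sp"
  shows "ext_coeff \<Omega> wt p \<alpha> g = coeff \<alpha> g"
  unfolding ext_coeff_eq_coeff_P[OF Ap_Lp[OF g] \<alpha>]
  by (intro coeff_cong Ap_Lp P_Ap g P_reproduces)

text \<open>The norm of the monomial cancels between the bound for its coefficient and the bound for
  its values on a compact set, which leaves a summable majorant. The sum is identified with
  \<open>g\<close> along the cubes, where it is the limit of the expansion of
  \<open>P g\<close>.\<close>

lemma Ap_laurent_series:
  assumes g: "g \<in> Ap"
  shows "laurent_series \<Omega> g (\<lambda>\<alpha>. if \<alpha> \<in> Sp then coeff \<alpha> g else 0)" (is "laurent_series \<Omega> g ?c")
proof -
  have bound: "\<exists>H. H summable_on UNIV \<and> (\<forall>\<alpha>. \<forall>z\<in>K. norm (?c \<alpha> * monom \<alpha> z) \<le> H \<alpha>)"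
    if K: "compact K" "K \<subseteq> \<Omega>" for K
  proof -
    obtain h where h: "h summable_on UNIV" "\<And>\<alpha>. 0 \<le> h \<alpha>"
      "\<And>\<alpha> z. \<alpha> \<in> Sp \<Longrightarrow> z \<in> K \<Longrightarrow> norm (monom \<alpha> z) \<le> h \<alpha> * pnorm (monom \<alpha>)"
      using monom_compact_bound[OF K] by blast
    have "norm (?c \<alpha> * monom \<alpha> z) \<le> pnorm g * h \<alpha>" if z: "z \<in> K" for \<alpha> z
    proof (cases "\<alpha> \<in> Sp")
      case True
      have "norm (coeff \<alpha> g) * norm (monom \<alpha> z) \<le> pnorm g / pnorm (monom \<alpha>) * (h \<alpha> * pnorm (monom \<alpha>))"
        using True z g by (intro mult_mono coeff_bound Ap_Lp h(3) divide_nonneg_nonneg pnorm_nonneg) auto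
      then show ?thesis using True pnorm_monom_pos[OF True] by (simp add: norm_mult)
    next
      case False
      then show ?thesis using h(2) pnorm_nonneg by simp
    qed
    then show ?thesis
      by (intro exI[of _ "\<lambda>\<alpha>. pnorm g * h \<alpha>"] conjI summable_on_cmult_right h(1)) blast
  qed
  have "((\<lambda>\<alpha>. ?c \<alpha> * monom \<alpha> z) has_sum g z) UNIV" if z: "z \<in> \<Omega>" for z
  proof -
    have "\<exists>H. H summable_on UNIV \<and> (\<forall>\<alpha>. \<forall>z\<in>{z}. norm (?c \<alpha> * monom \<alpha> z) \<le> H \<alpha>)"
      by (rule bound) (use z in auto)
    then obtain H where H: "H summable_on UNIV" "\<And>\<alpha>. norm (?c \<alpha> * monom \<alpha> z) \<le> H \<alpha>"
      by blast
    have "(\<lambda>\<alpha>. norm (?c \<alpha> * monom \<alpha> z)) summable_on UNIV"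
      by (rule summable_on_comparison_test[OF H(1)]) (use H(2) in auto)
    then have "(\<lambda>\<alpha>. ?c \<alpha> * monom \<alpha> z) summable_on UNIV"
      by (rule abs_summable_summable)
    then obtain s where "((\<lambda>\<alpha>. ?c \<alpha> * monom \<alpha> z) has_sum s) UNIV"
      unfolding summable_on_def by blast
    moreover from this have "((\<lambda>\<alpha>. ?c \<alpha> * monom \<alpha> z) has_sum s) Sp"
      by (subst has_sum_cong_neutral[where g="\<lambda>\<alpha>. ?c \<alpha> * monom \<alpha> z" and S=Sp and T=UNIV]) auto
    then have "(\<lambda>N. \<Sum>\<alpha>\<in>trunc N. ?c \<alpha> * monom \<alpha> z) \<longlonglongrightarrow> s"
      by (rule has_sum_imp_trunc_limit)
    moreover have "(\<Sum>\<alpha>\<in>trunc N. ?c \<alpha> * monom \<alpha> z) = (\<Sum>\<alpha>\<in>trunc N. ext_coeff \<Omega> wt p \<alpha> g * monom \<alpha> z)" for N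
      using trunc_set_subset[of \<Omega> wt p N] by (intro sum.cong refl) (auto simp: ext_coeff_Ap[OF g])
    ultimately show ?thesis
      using P_pointwise_limit[OF Ap_Lp[OF g] z] P_reproduces[OF g z] LIMSEQ_unique by auto
  qed
  moreover have "(\<lambda>\<alpha>. SUP z\<in>K. norm (?c \<alpha> * monom \<alpha> z)) summable_on UNIV"
    if K: "compact K" "K \<subseteq> \<Omega>" "K \<noteq> {}" for K
  proof -
    obtain H where H: "H summable_on UNIV" "\<And>\<alpha> z. z \<in> K \<Longrightarrow> norm (?c \<alpha> * monom \<alpha> z) \<le> H \<alpha>"
      using bound[OF K(1,2)] by blast
    obtain a where a: "a \<in> K" using K(3) by blast
    show ?thesis
    proof (rule summable_on_comparison_test[OF H(1)])
      fix \<alpha>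
      show "(SUP z\<in>K. norm (?c \<alpha> * monom \<alpha> z)) \<le> H \<alpha>"
        by (rule cSUP_least[OF K(3) H(2)])
      have "norm (?c \<alpha> * monom \<alpha> a) \<le> (SUP z\<in>K. norm (?c \<alpha> * monom \<alpha> z))"
        by (rule cSUP_upper[OF a bdd_aboveI2[OF H(2)]])
      then show "0 \<le> (SUP z\<in>K. norm (?c \<alpha> * monom \<alpha> z))"
        by (rule order_trans[OF norm_ge_zero])
    qed
  qed
  ultimately show ?thesis unfolding laurent_series_def by blast
qed

lemma laurent_coeff_Ap:
  assumes g: "g \<in> Ap" and \<alpha>: "\<alpha> \<in> Sp"
  shows "laurent_coeff \<Omega> \<alpha> g = coeff \<alpha> g"
proof -
  have "(THE c. laurent_series \<Omega> g c) = (\<lambda>\<alpha>. if \<alpha> \<in> Sp then coeff \<alpha> g else 0)"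
    using Ap_laurent_series[OF g] laurent_series_unique[OF open_\<Omega> nonempty_\<Omega> reinhardt_\<Omega>]
    by (intro the_equality)
  then show ?thesis using \<alpha> by (simp add: laurent_coeff_def)
qed

text \<open>Hoelder's inequality gives the upper bound, and the monomial itself attains it.\<close>

lemma coeff_opnorm_eq:
  assumes \<alpha>: "\<alpha> \<in> Sp"
  shows "coeff_opnorm \<Omega> wt p \<alpha> = 1 / pnorm (monom \<alpha>)"
  unfolding coeff_opnorm_def
proof (rule cSup_eq_maximum)
  have "1 / pnorm (monom \<alpha>) = norm (laurent_coeff \<Omega> \<alpha> (monom \<alpha>)) / pnorm (monom \<alpha>)"
    by (simp add: laurent_coeff_Ap Sp_Ap \<alpha> coeff_monom)
  then show "1 / pnorm (monom \<alpha>) \<in> {norm (laurent_coeff \<Omega> \<alpha> f) / pnorm f |f. f \<in> Ap \<and> 0 < pnorm f} \<union> {0}"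
    using Sp_Ap[OF \<alpha>] pnorm_monom_pos[OF \<alpha>] by blast
  fix x assume "x \<in> {norm (laurent_coeff \<Omega> \<alpha> f) / pnorm f |f. f \<in> Ap \<and> 0 < pnorm f} \<union> {0}"
  then consider "x = 0" | f where "x = norm (laurent_coeff \<Omega> \<alpha> f) / pnorm f" "f \<in> Ap" "0 < pnorm f"
    by blast
  then show "x \<le> 1 / pnorm (monom \<alpha>)"
  proof cases
    case 1
    then show ?thesis using pnorm_nonneg by simp
  next
    case (2 f)
    then have "norm (laurent_coeff \<Omega> \<alpha> f) \<le> pnorm f / pnorm (monom \<alpha>)"
      using coeff_bound[OF Ap_Lp \<alpha>] laurent_coeff_Ap[OF _ \<alpha>] by simp
    then have "x \<le> pnorm f / pnorm (monom \<alpha>) / pnorm f"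
      unfolding 2(1) using 2(3) by (intro divide_right_mono) auto
    then show ?thesis using 2 by simp
  qed
qed

text \<open>Remove from \<open>f\<close> its component along the monomial e. The rest
  \<open>k\<close> lies in the kernel of \<open>coeff \<alpha>\<close>, so the norm is stationary at
  e in direction \<open>k\<close>. If \<open>\<Phi> k\<close> were nonzero, \<Phi> would grow
  linearly along a multiple of \<open>k\<close>, and its norm bound would force the norm to grow
  linearly as well.\<close>

lemma norm_preserving_extension_unique:
  assumes \<alpha>: "\<alpha> \<in> Sp"
    and one: "\<Phi> (monom \<alpha>) = 1"
    and add: "\<And>f g. f \<in> Lp \<Longrightarrow> g \<in> Lp \<Longrightarrow> \<Phi> (\<lambda>z. f z + g z) = \<Phi> f + \<Phi> g"
    and cmult: "\<And>f c. f \<in> Lp \<Longrightarrow> \<Phi> (\<lambda>z. c * f z) = c * \<Phi> f"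
    and bound: "\<And>f. f \<in> Lp \<Longrightarrow> norm (\<Phi> f) \<le> 1 / pnorm (monom \<alpha>) * pnorm f"
    and f: "f \<in> Lp"
  shows "\<Phi> f = coeff \<alpha> f"
proof -
  let ?e = "monom \<alpha>"
  have e: "?e \<in> Lp" by (rule Sp_Lp[OF \<alpha>])
  define k where "k z = f z + (- coeff \<alpha> f) * ?e z" for z
  have k: "k \<in> Lp" unfolding k_def using p_pos(1) by (intro Lp_space_add Lp_space_cmult f e)
  have ck: "coeff \<alpha> k = 0"
    unfolding k_def using coeff_add[OF f Lp_space_cmult[OF e] \<alpha>, of "- coeff \<alpha> f"]
    by (simp only: coeff_cmult coeff_monom[OF \<alpha>]) simp
  have \<Phi>k: "\<Phi> k = \<Phi> f - coeff \<alpha> f"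
    unfolding k_def using add[OF f Lp_space_cmult[OF e], of "- coeff \<alpha> f"] cmult[OF e, of "- coeff \<alpha> f"] one by simp
  \<comment> \<open>The conjugate factor makes \<open>\<Phi> h\<close> the nonnegative real number
    |\<Phi> k|^2, so that the modulus of 1 + s \<Phi> h is computed exactly.\<close>
  define h where "h z = cnj (\<Phi> k) * k z" for z
  have h: "h \<in> Lp" unfolding h_def by (rule Lp_space_cmult[OF k])
  have "coeff \<alpha> h = 0" unfolding h_def coeff_cmult ck by simp
  then have orth: "(\<integral>z. h z * dual_monom \<alpha> z \<partial>M) = 0"
    using pnorm_monom_pos[OF \<alpha>] by (simp add: coeff_def)
  have \<Phi>h: "\<Phi> h = of_real ((norm (\<Phi> k))\<^sup>2)"
    unfolding h_def cmult[OF k] by (simp add: complex_norm_square[symmetric] mult.commute)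
  have "(norm (\<Phi> k))\<^sup>2 = 0"
  proof (rule norming_functional_vanishes[where h=h and e="?e" and M=M and p=p])
    fix n :: nat
    define s where "s = 1 / real (Suc n)"
    have s: "0 < s" by (simp add: s_def)
    have g: "(\<lambda>z. ?e z + of_real s * h z) \<in> Lp"
      using p_pos(1) by (intro Lp_space_add Lp_space_cmult e h)
    have "\<Phi> (\<lambda>z. ?e z + of_real s * h z) = of_real (1 + s * (norm (\<Phi> k))\<^sup>2)"
      using add[OF e Lp_space_cmult[OF h], of "of_real s"] cmult[OF h, of "of_real s"] one \<Phi>h by simp
    then have "norm (\<Phi> (\<lambda>z. ?e z + of_real s * h z)) = 1 + s * (norm (\<Phi> k))\<^sup>2"
      using s by (simp only: norm_of_real) simp
    then have "(1 + s * (norm (\<Phi> k))\<^sup>2) * pnorm ?e \<le> pnorm (\<lambda>z. ?e z + of_real s * h z)"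
      using bound[OF g] pnorm_monom_pos[OF \<alpha>] by (simp add: field_simps)
    then have "((1 + s * (norm (\<Phi> k))\<^sup>2) * pnorm ?e) powr p \<le> pnorm (\<lambda>z. ?e z + of_real s * h z) powr p"
      using s p_pos pnorm_nonneg by (intro powr_mono2) auto
    then have "(1 + s * (norm (\<Phi> k))\<^sup>2) powr p * pnorm ?e powr p \<le> pnorm (\<lambda>z. ?e z + of_real s * h z) powr p"
      using s by (subst (asm) powr_mult) (auto simp: pnorm_nonneg)
    then show "(1 + (norm (\<Phi> k))\<^sup>2 / real (Suc n)) powr p * (\<integral>z. norm (?e z) powr p \<partial>M)
       \<le> (\<integral>z. norm (?e z + of_real (1 / real (Suc n)) * h z) powr p \<partial>M)"
      unfolding pnorm_powr[OF g] pnorm_powr[OF e] by (simp only: s_def times_divide_eq_left mult_1)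
  qed (use Lp_measurable h Lp_integrable e integral_monom_pos[OF \<alpha>] p_gt_1 orth in \<open>auto simp: dual_monom_def\<close>)
  then show ?thesis using \<Phi>k by simp
qed

text \<open>Resolves the definite description: \<open>coeff \<alpha>\<close>, cut off to 0 outside
  \<open>Lp\<close>, meets it, and for a competitor the agreement on \<open>Ap\<close> enters
  through its value at the monomial.\<close>

lemma ext_coeff_eq:
  assumes \<alpha>: "\<alpha> \<in> Sp" and f: "f \<in> Lp"
  shows "ext_coeff \<Omega> wt p \<alpha> f = coeff \<alpha> f"
proof -
  have "ext_coeff \<Omega> wt p \<alpha> = (\<lambda>f. if f \<in> Lp then coeff \<alpha> f else 0)"
    unfolding ext_coeff_def coeff_opnorm_eq[OF \<alpha>]
  proof (rule the_equality, goal_cases)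
    case 1
    show ?case
      using p_pos(1) coeff_bound[OF _ \<alpha>]
      by (auto simp: Ap_Lp laurent_coeff_Ap \<alpha> Lp_space_add Lp_space_cmult coeff_add coeff_cmult)
  next
    case (2 \<Phi>)
    show ?case
    proof
      fix f
      have "\<Phi> f = coeff \<alpha> f" if "f \<in> Lp"
      proof (rule norm_preserving_extension_unique[OF \<alpha>])
        show "\<Phi> (monom \<alpha>) = 1"
          using 2 Sp_Ap[OF \<alpha>] laurent_coeff_Ap[OF Sp_Ap[OF \<alpha>] \<alpha>] coeff_monom[OF \<alpha>] by simp
      qed (use 2 that in auto)
      then show "\<Phi> f = (if f \<in> Lp then coeff \<alpha> f else 0)" using 2 by simp
    qed
  qed
  then show ?thesis using f by simp
qed

end

section \<open>The monomial basis kernel\<close>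

text \<open>Jensen's inequality for the q-th power with weights x_i divided by their sum, written
  without the division. For vanishing total weight, or infinite \<open>F\<close>, the left-hand side
  is 0.\<close>

lemma sum_powr_le_weighted:
  fixes x g :: "'a \<Rightarrow> real"
  assumes q: "1 < q" and x: "\<And>i. i \<in> F \<Longrightarrow> 0 \<le> x i" and g: "\<And>i. i \<in> F \<Longrightarrow> 0 \<le> g i"
  shows "(\<Sum>i\<in>F. x i * g i) powr q \<le> (\<Sum>i\<in>F. x i) powr (q - 1) * (\<Sum>i\<in>F. x i * g i powr q)"
proof (cases "finite F \<and> (\<Sum>i\<in>F. x i) \<noteq> 0")
  case False
  then have "(\<Sum>i\<in>F. x i * g i) = 0"
    using x by (auto simp: sum_nonneg_eq_0_iff)
  then show ?thesis using x g by (auto intro!: mult_nonneg_nonneg sum_nonneg)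
next
  case True
  define S T t where "S = (\<Sum>i\<in>F. x i)" and "T = (\<Sum>i\<in>F. x i * g i)" and "t = T / S"
  have S: "S > 0" using True x sum_nonneg[of F x] by (simp add: S_def less_le)
  have T: "T \<ge> 0" unfolding T_def using x g by (intro sum_nonneg) auto
  have t: "t \<ge> 0" "T = S * t" using S T by (auto simp: t_def)
  have "S * t powr q = T * t powr (q - 1)"
    using powr_mult_base[OF t(1), of "q - 1"] by (simp add: t(2))
  also have "\<dots> = (\<Sum>i\<in>F. x i * (g i * t powr (q - 1)))"
    by (simp add: T_def sum_distrib_right mult.assoc)
  \<comment> \<open>Young's inequality here says that the q-th power lies above its tangent at the
    weighted mean \<open>t\<close>.\<close>
  also have "\<dots> \<le> (\<Sum>i\<in>F. x i * (g i powr q / q + (1 - 1/q) * t powr q))"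
    using x g t q by (intro sum_mono mult_left_mono Young_powr) auto
  also have "\<dots> = (\<Sum>i\<in>F. x i * g i powr q) / q + (1 - 1/q) * (S * t powr q)"
    by (simp add: S_def distrib_left sum.distrib sum_divide_distrib sum_distrib_left sum_distrib_right mult_ac)
  finally have "S * t powr q / q \<le> (\<Sum>i\<in>F. x i * g i powr q) / q"
    by (simp add: algebra_simps)
  then have "S * t powr q \<le> (\<Sum>i\<in>F. x i * g i powr q)"
    using q by (simp add: divide_le_cancel)
  then have "S powr (q - 1) * (S * t powr q) \<le> S powr (q - 1) * (\<Sum>i\<in>F. x i * g i powr q)"
    by (intro mult_left_mono) auto
  moreover have "S powr (q - 1) * (S * t powr q) = T powr q"
    using S t powr_mult_base[of S "q - 1"] by (simp add: powr_mult mult_ac)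
  ultimately show ?thesis by (simp add: S_def T_def)
qed

context weighted_reinhardt
begin

definition kernel_term :: "complex^'n \<Rightarrow> ('n \<Rightarrow> int) \<Rightarrow> complex^'n \<Rightarrow> complex" where
  "kernel_term z \<alpha> w = monom \<alpha> z * dual_monom \<alpha> w / of_real (pnorm (monom \<alpha>) powr p)"

lemma kernel_term_measurable [measurable]: "kernel_term z \<alpha> \<in> borel_measurable M"
  unfolding kernel_term_def by measurable

lemma mb_kernel_eq: "mb_kernel \<Omega> wt p z w = lim (\<lambda>N. \<Sum>\<alpha>\<in>trunc_set \<Omega> wt p N. kernel_term z \<alpha> w)"
  by (simp add: mb_kernel_def kernel_term_def dual_monom_def mult.assoc)

lemma mb_kernel_measurable [measurable]: "mb_kernel \<Omega> wt p z \<in> borel_measurable M"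
  unfolding mb_kernel_eq[abs_def] by measurable

text \<open>Splits the term into a factor in \<open>z\<close>, summable over \<open>Sp\<close> for z
  in \<Omega>, and a function of \<open>w\<close> whose q-th power has integral 1.\<close>

lemma norm_kernel_term:
  assumes "\<alpha> \<in> Sp"
  shows "norm (kernel_term z \<alpha> w) = norm (monom \<alpha> z) / pnorm (monom \<alpha>) * (norm (monom \<alpha> w) / pnorm (monom \<alpha>)) powr (p - 1)"
proof -
  have "pnorm (monom \<alpha>) powr p = pnorm (monom \<alpha>) * pnorm (monom \<alpha>) powr (p - 1)"
    using pnorm_nonneg by (simp add: powr_mult_base)
  moreover have "norm (dual_monom \<alpha> w) = norm (monom \<alpha> w) powr (p - 1)"
    unfolding dual_monom_def by (rule norm_dual_element)
  ultimately show ?thesis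
    by (simp add: kernel_term_def norm_divide norm_mult powr_divide pnorm_nonneg)
qed

lemma integral_kernel_term:
  assumes "f \<in> Lp" "\<alpha> \<in> Sp"
  shows "integrable M (\<lambda>w. kernel_term z \<alpha> w * f w)"
    and "(\<integral>w. kernel_term z \<alpha> w * f w \<partial>M) = coeff \<alpha> f * monom \<alpha> z"
proof -
  have eq: "kernel_term z \<alpha> w * f w = (monom \<alpha> z / of_real (pnorm (monom \<alpha>) powr p)) * (f w * dual_monom \<alpha> w)" for w
    by (simp add: kernel_term_def)
  show "integrable M (\<lambda>w. kernel_term z \<alpha> w * f w)"
    unfolding eq using integrable_pairing[OF assms] by (intro integrable_mult_right) auto
  show "(\<integral>w. kernel_term z \<alpha> w * f w \<partial>M) = coeff \<alpha> f * monom \<alpha> z"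
    unfolding eq integral_mult_right_zero by (simp add: coeff_def)
qed

text \<open>The \<open>L\<^sup>q\<close> norm of the term of index \<open>\<alpha>\<close> is \<open>\<bar>e\<^sub>\<alpha>(z)\<bar> / \<parallel>e\<^sub>\<alpha>\<parallel>\<close>, which is summable over \<open>Sp\<close>: the kernel
  series converges absolutely in \<open>L\<^sup>q\<close>, hence almost everywhere.\<close>
lemma kernel_dominated:
  assumes z: "z \<in> \<Omega>" and q: "q = p / (p - 1)"
  obtains U :: "complex^'n \<Rightarrow> ennreal" where "U \<in> borel_measurable M" "(\<integral>\<^sup>+w. U w \<partial>M) < \<infinity>"
    "\<And>N w. ennreal ((\<Sum>\<alpha>\<in>trunc_set \<Omega> wt p N. norm (kernel_term z \<alpha> w)) powr q) \<le> U w"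
proof -
  have q1: "1 < q" "(p - 1) * q = p" using p_gt_1 by (auto simp: q field_simps)
  have "\<exists>h. h summable_on UNIV \<and> (\<forall>\<alpha>. 0 \<le> h \<alpha>) \<and>
     (\<forall>\<alpha>\<in>Sp. \<forall>z\<in>{z}. norm (monom \<alpha> z) \<le> h \<alpha> * pnorm (monom \<alpha>))"
    by (rule monom_compact_bound) (use z in auto)
  then obtain h where h: "h summable_on UNIV" "\<And>\<alpha>. 0 \<le> h \<alpha>"
      "\<And>\<alpha>. \<alpha> \<in> Sp \<Longrightarrow> norm (monom \<alpha> z) \<le> h \<alpha> * pnorm (monom \<alpha>)"
    by blast
  define X where "X = infsum h UNIV"
  define x where "x \<alpha> = norm (monom \<alpha> z) / pnorm (monom \<alpha>)" for \<alpha>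
  define g where "g \<alpha> w = (norm (monom \<alpha> w) / pnorm (monom \<alpha>)) powr (p - 1)" for \<alpha> w
  let ?T = "trunc_set \<Omega> wt p"
  have TS: "\<alpha> \<in> Sp" if "\<alpha> \<in> ?T N" for \<alpha> N using that trunc_set_subset by blast
  have x0: "0 \<le> x \<alpha>" for \<alpha> by (simp add: x_def pnorm_nonneg)
  have xs: "(\<Sum>\<alpha>\<in>?T N. x \<alpha>) \<le> X" for N
  proof -
    have "(\<Sum>\<alpha>\<in>?T N. x \<alpha>) \<le> (\<Sum>\<alpha>\<in>?T N. h \<alpha>)"
      using h(3) TS pnorm_monom_pos by (intro sum_mono) (auto simp: x_def pos_divide_le_eq)
    also have "\<dots> \<le> X"
      unfolding X_def by (rule finite_sum_le_infsum[OF h(1) finite_trunc_set]) (use h(2) in auto)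
    finally show ?thesis .
  qed
  have X0: "0 \<le> X" unfolding X_def by (rule infsum_nonneg) (use h in auto)
  define G where "G N w = (\<Sum>\<alpha>\<in>?T N. norm (kernel_term z \<alpha> w))" for N w
  have [measurable]: "G N \<in> borel_measurable M" for N unfolding G_def by measurable
  have G0: "0 \<le> G N w" for N w unfolding G_def by (intro sum_nonneg) auto
  have Gmono: "G m w \<le> G n w" if "m \<le> n" for m n w
    unfolding G_def by (intro sum_mono2 finite_trunc_set trunc_set_mono that) auto
  have gq: "g \<alpha> w powr q = norm (monom \<alpha> w) powr p / pnorm (monom \<alpha>) powr p" for \<alpha> w
    by (simp add: g_def powr_powr q1 powr_divide pnorm_nonneg)
  \<comment> \<open>Jensen takes the place of the triangle inequality in L^q: what remains is linear
    in functions with integral 1.\<close>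
  have Gle: "G N w powr q \<le> X powr (q - 1) * (\<Sum>\<alpha>\<in>?T N. x \<alpha> * g \<alpha> w powr q)" for N w
  proof -
    have "G N w = (\<Sum>\<alpha>\<in>?T N. x \<alpha> * g \<alpha> w)"
      unfolding G_def x_def g_def by (intro sum.cong refl norm_kernel_term TS)
    then have "G N w powr q \<le> (\<Sum>\<alpha>\<in>?T N. x \<alpha>) powr (q - 1) * (\<Sum>\<alpha>\<in>?T N. x \<alpha> * g \<alpha> w powr q)"
      using sum_powr_le_weighted[OF q1(1), of "?T N" x "\<lambda>\<alpha>. g \<alpha> w"] x0 by (simp add: g_def)
    also have "\<dots> \<le> X powr (q - 1) * (\<Sum>\<alpha>\<in>?T N. x \<alpha> * g \<alpha> w powr q)"
      using q1 x0 xs by (intro mult_right_mono powr_mono2 sum_nonneg) auto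
    finally show ?thesis .
  qed
  have gint: "integrable M (\<lambda>w. g \<alpha> w powr q)" "(\<integral>w. g \<alpha> w powr q \<partial>M) = 1" if \<alpha>: "\<alpha> \<in> Sp" for \<alpha>
    unfolding gq pnorm_powr[OF Sp_Lp[OF \<alpha>]] using Lp_integrable[OF Sp_Lp[OF \<alpha>]] integral_monom_pos[OF \<alpha>] by auto
  have Gint: "(\<integral>\<^sup>+w. ennreal (G N w powr q) \<partial>M) \<le> ennreal (X powr (q - 1) * X)" for N
  proof -
    have int: "integrable M (\<lambda>w. X powr (q - 1) * (\<Sum>\<alpha>\<in>?T N. x \<alpha> * g \<alpha> w powr q))"
      by (intro integrable_mult_right Bochner_Integration.integrable_sum gint TS) auto
    have "(\<integral>\<^sup>+w. ennreal (G N w powr q) \<partial>M) \<le> (\<integral>\<^sup>+w. ennreal (X powr (q - 1) * (\<Sum>\<alpha>\<in>?T N. x \<alpha> * g \<alpha> w powr q)) \<partial>M)"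
      by (intro nn_integral_mono ennreal_leI Gle)
    also have "\<dots> = ennreal (\<integral>w. X powr (q - 1) * (\<Sum>\<alpha>\<in>?T N. x \<alpha> * g \<alpha> w powr q) \<partial>M)"
      by (rule nn_integral_eq_integral[OF int]) (auto intro!: mult_nonneg_nonneg sum_nonneg x0)
    also have "(\<integral>w. X powr (q - 1) * (\<Sum>\<alpha>\<in>?T N. x \<alpha> * g \<alpha> w powr q) \<partial>M) = X powr (q - 1) * (\<Sum>\<alpha>\<in>?T N. x \<alpha>)"
      using gint TS by (simp add: Bochner_Integration.integral_sum)
    also have "ennreal \<dots> \<le> ennreal (X powr (q - 1) * X)"
      by (intro ennreal_leI mult_left_mono xs) auto
    finally show ?thesis .
  qed
  \<comment> \<open>The absolute sums may diverge on a null set, so their supremum is kept in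
    \<open>ennreal\<close>. They increase with N because the truncations do, which permits monotone
    convergence.\<close>
  define U where "U w = (SUP N. ennreal (G N w powr q))" for w
  have [measurable]: "U \<in> borel_measurable M" unfolding U_def by measurable
  have "(\<integral>\<^sup>+w. U w \<partial>M) = (SUP N. \<integral>\<^sup>+w. ennreal (G N w powr q) \<partial>M)"
    unfolding U_def
    by (rule nn_integral_monotone_convergence_SUP)
       (use q1 in \<open>auto intro!: incseq_SucI le_funI ennreal_leI powr_mono2 Gmono G0\<close>)
  also have "\<dots> \<le> ennreal (X powr (q - 1) * X)"
    by (rule SUP_least) (rule Gint)
  finally have "(\<integral>\<^sup>+w. U w \<partial>M) < \<infinity>"
    by (rule order.strict_trans1) simp
  moreover have "ennreal ((\<Sum>\<alpha>\<in>?T N. norm (kernel_term z \<alpha> w)) powr q) \<le> U w" for N w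
    unfolding U_def G_def by (rule SUP_upper) simp
  ultimately show ?thesis by (intro that[of U]) auto
qed

lemma finite_subset_trunc_set:
  assumes "finite F" "F \<subseteq> Sp"
  shows "\<exists>N. F \<subseteq> trunc_set \<Omega> wt p N"
proof -
  have "\<forall>\<^sub>F Y in finite_subsets_at_top Sp. F \<subseteq> Y"
    using assms unfolding eventually_finite_subsets_at_top by blast
  then have "\<forall>\<^sub>F N in sequentially. F \<subseteq> trunc_set \<Omega> wt p N"
    unfolding trunc_set_def using filterlim_supnorm_le by (rule eventually_compose_filterlim)
  then show ?thesis by (auto simp: eventually_sequentially)
qed

text \<open>Where the majorant is finite, its q-th root bounds all absolute partial sums, so the
  series is absolutely summable and the \<open>lim\<close> in \<open>mb_kernel\<close> is a genuine
  limit.\<close>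

lemma kernel_pointwise:
  assumes q: "1 < q"
    and U: "\<And>N. ennreal ((\<Sum>\<alpha>\<in>trunc_set \<Omega> wt p N. norm (kernel_term z \<alpha> w)) powr q) \<le> U" "U < \<infinity>"
  shows "(\<lambda>N. \<Sum>\<alpha>\<in>trunc_set \<Omega> wt p N. kernel_term z \<alpha> w) \<longlonglongrightarrow> mb_kernel \<Omega> wt p z w"
    and "norm (\<Sum>\<alpha>\<in>trunc_set \<Omega> wt p N. kernel_term z \<alpha> w) powr q \<le> enn2real U"
    and "norm (mb_kernel \<Omega> wt p z w) powr q \<le> enn2real U"
proof -
  let ?T = "trunc_set \<Omega> wt p"
  define B where "B = enn2real U powr (1/q)"
  have UB: "B powr q = enn2real U" using q by (simp add: B_def powr_powr)
  have G: "(\<Sum>\<alpha>\<in>?T N. norm (kernel_term z \<alpha> w)) \<le> B" for N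
  proof -
    let ?G = "\<Sum>\<alpha>\<in>?T N. norm (kernel_term z \<alpha> w)"
    have G0: "0 \<le> ?G" by (intro sum_nonneg) auto
    have "?G powr q \<le> enn2real U"
      using enn2real_mono[OF U(1)[of N]] U(2) by simp
    then have "(?G powr q) powr (1/q) \<le> B"
      unfolding B_def using q by (intro powr_mono2) auto
    then show ?thesis using G0 q by (simp add: powr_powr)
  qed
  have SB: "norm (\<Sum>\<alpha>\<in>?T N. kernel_term z \<alpha> w) \<le> B" for N
    by (rule order_trans[OF norm_sum G])
  have powB: "norm c powr q \<le> enn2real U" if "norm c \<le> B" for c :: complex
    using powr_mono2[of q "norm c" B] that q by (simp add: UB)
  then show "norm (\<Sum>\<alpha>\<in>?T N. kernel_term z \<alpha> w) powr q \<le> enn2real U"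
    using SB by blast
  have "(\<lambda>\<alpha>. norm (kernel_term z \<alpha> w)) summable_on Sp"
  proof (rule nonneg_bdd_above_summable_on)
    show "bdd_above (sum (\<lambda>\<alpha>. norm (kernel_term z \<alpha> w)) ` {F. F \<subseteq> Sp \<and> finite F})"
    proof (rule bdd_aboveI2)
      fix F assume "F \<in> {F. F \<subseteq> Sp \<and> finite F}"
      then obtain N where "F \<subseteq> ?T N" using finite_subset_trunc_set by blast
      then have "(\<Sum>\<alpha>\<in>F. norm (kernel_term z \<alpha> w)) \<le> (\<Sum>\<alpha>\<in>?T N. norm (kernel_term z \<alpha> w))"
        by (intro sum_mono2 finite_trunc_set) auto
      also have "\<dots> \<le> B" by (rule G)
      finally show "(\<Sum>\<alpha>\<in>F. norm (kernel_term z \<alpha> w)) \<le> B" .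
    qed
  qed simp
  then have "(\<lambda>\<alpha>. kernel_term z \<alpha> w) summable_on Sp" by (rule abs_summable_summable)
  then have "((\<lambda>\<alpha>. kernel_term z \<alpha> w) has_sum infsum (\<lambda>\<alpha>. kernel_term z \<alpha> w) Sp) Sp"
    by (rule has_sum_infsum)
  then have "(\<lambda>N. \<Sum>\<alpha>\<in>?T N. kernel_term z \<alpha> w) \<longlonglongrightarrow> infsum (\<lambda>\<alpha>. kernel_term z \<alpha> w) Sp"
    by (rule has_sum_imp_trunc_limit)
  then show lim: "(\<lambda>N. \<Sum>\<alpha>\<in>?T N. kernel_term z \<alpha> w) \<longlonglongrightarrow> mb_kernel \<Omega> wt p z w"
    unfolding mb_kernel_eq by (simp add: limI)
  have "norm (mb_kernel \<Omega> wt p z w) \<le> B"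
    using tendsto_norm[OF lim] by (rule LIMSEQ_le_const2) (use SB in auto)
  then show "norm (mb_kernel \<Omega> wt p z w) powr q \<le> enn2real U" by (rule powB)
qed

lemma mb_kernel_Lq:
  assumes z: "z \<in> \<Omega>"
  shows "mb_kernel \<Omega> wt p z \<in> Lp_space \<Omega> wt (p / (p - 1))"
proof -
  define q where "q = p / (p - 1)"
  have q: "1 < q" using p_gt_1 by (simp add: q_def field_simps)
  obtain U where U [measurable]: "U \<in> borel_measurable M" and Ufin: "(\<integral>\<^sup>+w. U w \<partial>M) < \<infinity>"
    and Ub: "\<And>N w. ennreal ((\<Sum>\<alpha>\<in>trunc_set \<Omega> wt p N. norm (kernel_term z \<alpha> w)) powr q) \<le> U w"
    using kernel_dominated[OF z q_def] by blast
  have "AE w in M. U w \<noteq> \<infinity>" by (rule nn_integral_PInf_AE) (use Ufin in auto)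
  then have "AE w in M. ennreal (norm (mb_kernel \<Omega> wt p z w) powr q) \<le> U w"
  proof eventually_elim
    case (elim w)
    then have fin: "U w < \<infinity>" by (simp add: less_top)
    have "ennreal (norm (mb_kernel \<Omega> wt p z w) powr q) \<le> ennreal (enn2real (U w))"
      by (intro ennreal_leI kernel_pointwise(3)[OF q Ub fin])
    then show ?case using fin by (simp only: ennreal_enn2real infinity_ennreal_def)
  qed
  then have "(\<integral>\<^sup>+w. ennreal (norm (mb_kernel \<Omega> wt p z w) powr q) \<partial>M) \<le> (\<integral>\<^sup>+w. U w \<partial>M)"
    by (rule nn_integral_mono_AE)
  then show ?thesis
    using Ufin unfolding Lp_space_def q_def[symmetric] by (auto intro: order.strict_trans1)
qed

end

lemma (in monomial_basis_projection) P_eq_kernel_integral: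
  assumes f: "f \<in> Lp" and z: "z \<in> \<Omega>"
  shows "P f z = (\<integral>w. mb_kernel \<Omega> wt p z w * f w \<partial>M)"
proof -
  define q where "q = p / (p - 1)"
  have q: "1 < q" "1/p + 1/q = 1" using p_gt_1 by (auto simp: q_def field_simps)
  obtain U where U [measurable]: "U \<in> borel_measurable M" and Ufin: "(\<integral>\<^sup>+w. U w \<partial>M) < \<infinity>"
    and Ub: "\<And>N w. ennreal ((\<Sum>\<alpha>\<in>trunc N. norm (kernel_term z \<alpha> w)) powr q) \<le> U w"
    using kernel_dominated[OF z q_def] by blast
  have AEU: "AE w in M. U w \<noteq> \<infinity>" by (rule nn_integral_PInf_AE) (use Ufin in auto)
  note [measurable] = Lp_measurable[OF f]
  have "(\<integral>\<^sup>+w. ennreal (norm (enn2real (U w))) \<partial>M) \<le> (\<integral>\<^sup>+w. U w \<partial>M)"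
    by (intro nn_integral_mono) (simp add: ennreal_enn2real_if)
  then have Uint: "integrable M (\<lambda>w. enn2real (U w))"
    using Ufin by (intro integrableI_bounded) (auto intro: order.strict_trans1)
  let ?S = "\<lambda>N w. \<Sum>\<alpha>\<in>trunc N. kernel_term z \<alpha> w"
  have lim1: "(\<lambda>N. \<integral>w. ?S N w * f w \<partial>M) \<longlonglongrightarrow> (\<integral>w. mb_kernel \<Omega> wt p z w * f w \<partial>M)"
  \<comment> \<open>The majorant is Young's inequality for the product of |f| with the partial sums,
    whose q-th powers are at most \<open>U\<close> for every N.\<close>
  proof (rule integral_dominated_convergence[where w="\<lambda>w. norm (f w) powr p / p + enn2real (U w) / q"])
    show "integrable M (\<lambda>w. norm (f w) powr p / p + enn2real (U w) / q)"
      using Uint Lp_integrable[OF f] by simp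
    show "AE w in M. (\<lambda>N. ?S N w * f w) \<longlonglongrightarrow> mb_kernel \<Omega> wt p z w * f w"
      using AEU
    proof eventually_elim
      case (elim w)
      then have fin: "U w < \<infinity>" by (simp add: less_top)
      show ?case by (intro tendsto_mult kernel_pointwise(1)[OF q(1) Ub fin] tendsto_const)
    qed
    fix N
    show "AE w in M. norm (?S N w * f w) \<le> norm (f w) powr p / p + enn2real (U w) / q"
      using AEU
    proof eventually_elim
      case (elim w)
      then have fin: "U w < \<infinity>" by (simp add: less_top)
      have "norm (?S N w * f w) = norm (f w) * norm (?S N w)" by (simp add: norm_mult)
      also have "\<dots> \<le> norm (f w) powr p / p + norm (?S N w) powr q / q"
        by (rule Youngs_inequality) (use p_gt_1 q in auto)
      also have "\<dots> \<le> norm (f w) powr p / p + enn2real (U w) / q"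
        using kernel_pointwise(2)[OF q(1) Ub fin] q by (intro add_left_mono divide_right_mono) auto
      finally show ?case .
    qed
  qed measurable
  have "(\<integral>w. ?S N w * f w \<partial>M) = (\<Sum>\<alpha>\<in>trunc N. ext_coeff \<Omega> wt p \<alpha> f * monom \<alpha> z)" for N
  proof -
    have TS: "\<alpha> \<in> Sp" if "\<alpha> \<in> trunc N" for \<alpha> using that trunc_set_subset by blast
    show ?thesis
      unfolding sum_distrib_right
      by (subst Bochner_Integration.integral_sum)
         (auto intro!: sum.cong simp: TS integral_kernel_term[OF f] ext_coeff_eq[OF _ f])
  qed
  then show ?thesis
    using lim1 P_pointwise_limit[OF f z] LIMSEQ_unique by simp
qed

theorem theorem3p5:
  fixes \<Omega> :: "(complex^'n::finite) set"
    and wt :: "complex^'n \<Rightarrow> ennreal"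
    and p :: real
    and P :: "(complex^'n \<Rightarrow> complex) \<Rightarrow> (complex^'n \<Rightarrow> complex)"
  assumes "cdomain \<Omega>" and "bounded \<Omega>" and "pseudoconvex \<Omega>" and "reinhardt \<Omega>"
    and "1 < p"
    and "(\<lambda>z. wt z * indicator \<Omega> z) \<in> borel_measurable lebesgue"
    and "AE z in lebesgue. z \<in> \<Omega> \<longrightarrow> wt z > 0"
    and "admissible \<Omega> wt p" and "multi_radial \<Omega> wt"
    and "is_MBP \<Omega> wt p P"
  shows "(\<forall>f\<in>Lp_space \<Omega> wt p. \<forall>z\<in>\<Omega>.
            P f z = (\<integral>w. mb_kernel \<Omega> wt p z w * f w \<partial>wmeasure \<Omega> wt))
       \<and> (\<forall>z\<in>\<Omega>. mb_kernel \<Omega> wt p z \<in> Lp_space \<Omega> wt (p / (p - 1)))"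
proof -
  interpret monomial_basis_projection \<Omega> wt p P
    by unfold_locales (use assms in \<open>auto simp: cdomain_def\<close>)
  show ?thesis
    using P_eq_kernel_integral mb_kernel_Lq by blast
qed

end
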